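(* Let $R,S$ be two finite trees. Then $C(R)$ is isomorphic to a subgroup of $C(S)$ if and only if there exists a graph morphism $\varphi:R\to S$ which sends every vertex of degree $2$ to a vertex of degree $\geq 2$ and every vertex of degree $\geq 3$ to a vertex of degree $\geq 3$.
   Context: Given a simplicial graph $\Gamma$ (undirected, no loops or multiple edges), the right-angled Coxeter group is $C(\Gamma)=\langle u\in V(\Gamma)\mid u^2=1 \text{ for every } u\in V(\Gamma),\ [u,v]=1 \text{ if } \{u,v\}\in E(\Gamma)\rangle$. A graph morphism is a map between vertex-sets which sends adjacent vertices to adjacent vertices. *)

theory Defs
  imports "HOL-Algebra.Group" "Graph_Theory.Graph_Theory"
begin

section \<open>Group presentations\<close>

text \<open>
  A letter \<^term>\<open>(x, True)\<close> stands for the generator \<open>x\<close> and \<^term>\<open>(x, False)\<close> for its formal inverse.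
\<close>

type_synonym 'a word = "('a \<times> bool) list"

definition words :: "'a set \<Rightarrow> 'a word set" where
  "words X = lists (X \<times> UNIV)"

text \<open>
  The least congruence on words over \<open>X\<close> that identifies \<open>x x\<inverse>\<close>, \<open>x\<inverse> x\<close> and every relator with
  the empty word.
\<close>

inductive_set pres_rel :: "'a set \<Rightarrow> 'a word set \<Rightarrow> ('a word \<times> 'a word) set"
  for X :: "'a set" and Rel :: "'a word set" where
  refl: "w \<in> words X \<Longrightarrow> (w, w) \<in> pres_rel X Rel"
| cancel: "\<lbrakk>u \<in> words X; v \<in> words X; x \<in> X\<rbrakk>
    \<Longrightarrow> (u @ [(x, b), (x, \<not> b)] @ v, u @ v) \<in> pres_rel X Rel"
| relator: "\<lbrakk>u \<in> words X; v \<in> words X; r \<in> Rel; r \<in> words X\<rbrakk>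
    \<Longrightarrow> (u @ r @ v, u @ v) \<in> pres_rel X Rel"
| sym: "(v, w) \<in> pres_rel X Rel \<Longrightarrow> (w, v) \<in> pres_rel X Rel"
| trans: "\<lbrakk>(u, v) \<in> pres_rel X Rel; (v, w) \<in> pres_rel X Rel\<rbrakk> \<Longrightarrow> (u, w) \<in> pres_rel X Rel"

definition presented_group :: "'a set \<Rightarrow> 'a word set \<Rightarrow> 'a word set monoid" where
  "presented_group X Rel =
     \<lparr>carrier = words X // pres_rel X Rel,
      monoid.mult = (\<lambda>A B. \<Union>a\<in>A. \<Union>b\<in>B. pres_rel X Rel `` {a @ b}),
      one = pres_rel X Rel `` {[]}\<rparr>"

lemma pres_rel_words:
  assumes "(v, w) \<in> pres_rel X Rel"
  shows "v \<in> words X \<and> w \<in> words X"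
  using assms by induction (auto simp: words_def)

lemma equiv_pres_rel: "equiv (words X) (pres_rel X Rel)"
  by (intro equivI)
    (auto simp: refl_on_def sym_def trans_def dest: pres_rel_words
      intro: pres_rel.refl pres_rel.sym pres_rel.trans)

lemma pres_rel_append_context:
  assumes "(v, w) \<in> pres_rel X Rel" "p \<in> words X" "q \<in> words X"
  shows "(p @ v @ q, p @ w @ q) \<in> pres_rel X Rel"
  using assms
proof induction
  case (refl w)
  then show ?case by (intro pres_rel.refl) (auto simp: words_def)
next
  case (cancel u v x b)
  then show ?case
    using pres_rel.cancel[of "p @ u" X "v @ q" x b Rel] by (simp add: words_def)
next
  case (relator u v r)
  then show ?case
    using pres_rel.relator[of "p @ u" X "v @ q" r Rel] by (simp add: words_def)
qed (auto intro: pres_rel.sym pres_rel.trans)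

lemma congruent2_append:
  "congruent2 (pres_rel X Rel) (pres_rel X Rel) (\<lambda>a b. pres_rel X Rel `` {a @ b})"
proof (rule congruent2I[OF equiv_pres_rel equiv_pres_rel])
  fix y z w
  assume "(y, z) \<in> pres_rel X Rel" "w \<in> words X"
  then show "pres_rel X Rel `` {y @ w} = pres_rel X Rel `` {z @ w}"
    using pres_rel_append_context[of y z X Rel "[]" w]
    by (intro equiv_class_eq[OF equiv_pres_rel]) (simp add: words_def)
next
  fix y z w
  assume "(y, z) \<in> pres_rel X Rel" "w \<in> words X"
  then show "pres_rel X Rel `` {w @ y} = pres_rel X Rel `` {w @ z}"
    using pres_rel_append_context[of y z X Rel w "[]"]
    by (intro equiv_class_eq[OF equiv_pres_rel]) (simp add: words_def)
qed

lemma presented_group_mult: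
  assumes "a \<in> words X" "b \<in> words X"
  shows "pres_rel X Rel `` {a} \<otimes>\<^bsub>presented_group X Rel\<^esub> pres_rel X Rel `` {b}
    = pres_rel X Rel `` {a @ b}"
  using UN_equiv_class2[OF equiv_pres_rel equiv_pres_rel congruent2_append assms, of Rel]
  by (simp add: presented_group_def)

lemma pres_rel_inverse_word:
  assumes "w \<in> words X"
  shows "(rev (map (\<lambda>(x, b). (x, \<not> b)) w) @ w, []) \<in> pres_rel X Rel"
  using assms
proof (induction w)
  case Nil
  then show ?case by (auto simp: words_def intro: pres_rel.refl)
next
  case (Cons l w)
  obtain x b where l: "l = (x, b)" by (cases l)
  have *: "rev (map (\<lambda>(x, b). (x, \<not> b)) w) \<in> words X" "w \<in> words X" "x \<in> X"
    using Cons.prems by (auto simp: words_def l in_lists_conv_set)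
  show ?case
    using pres_rel.trans[OF pres_rel.cancel[OF *, of "\<not> b" Rel] Cons.IH[OF *(2)]]
    by (simp add: l)
qed

lemma group_presented_group: "group (presented_group X Rel)"
proof (rule groupI)
  let ?G = "presented_group X Rel"
  have carrier: "carrier ?G = (\<lambda>w. pres_rel X Rel `` {w}) ` words X"
    by (auto simp: presented_group_def quotient_def)
  have one: "\<one>\<^bsub>?G\<^esub> = pres_rel X Rel `` {[]}"
    by (simp add: presented_group_def)
  have app: "a @ b \<in> words X" if "a \<in> words X" "b \<in> words X" for a b :: "'a word"
    using that by (simp add: words_def)
  have Nil: "[] \<in> words X"
    by (simp add: words_def)
  show "\<one>\<^bsub>?G\<^esub> \<in> carrier ?G"
    using Nil by (auto simp: one carrier)
  show "x \<otimes>\<^bsub>?G\<^esub> y \<in> carrier ?G" if "x \<in> carrier ?G" "y \<in> carrier ?G" for x y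
    using that by (auto simp: carrier presented_group_mult app)
  show "x \<otimes>\<^bsub>?G\<^esub> y \<otimes>\<^bsub>?G\<^esub> z = x \<otimes>\<^bsub>?G\<^esub> (y \<otimes>\<^bsub>?G\<^esub> z)"
    if "x \<in> carrier ?G" "y \<in> carrier ?G" "z \<in> carrier ?G" for x y z
    using that by (auto simp: carrier presented_group_mult app)
  show "\<one>\<^bsub>?G\<^esub> \<otimes>\<^bsub>?G\<^esub> x = x" if "x \<in> carrier ?G" for x
    using that by (auto simp: carrier one presented_group_mult Nil)
  show "\<exists>y\<in>carrier ?G. y \<otimes>\<^bsub>?G\<^esub> x = \<one>\<^bsub>?G\<^esub>" if x: "x \<in> carrier ?G" for x
  proof -
    obtain w where w: "w \<in> words X" "x = pres_rel X Rel `` {w}"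
      using x by (auto simp: carrier)
    let ?v = "rev (map (\<lambda>(x, b). (x, \<not> b)) w)"
    have v: "?v \<in> words X"
      using w(1) by (auto simp: words_def in_lists_conv_set)
    have "pres_rel X Rel `` {?v} \<otimes>\<^bsub>?G\<^esub> x = \<one>\<^bsub>?G\<^esub>"
      unfolding w(2) one presented_group_mult[OF v w(1)]
      by (rule equiv_class_eq[OF equiv_pres_rel pres_rel_inverse_word[OF w(1)]])
    with v show ?thesis by (auto simp: carrier)
  qed
qed


section \<open>Simplicial graphs and trees\<close>

text \<open>
  A finite simplicial graph is a \<^locale>\<open>pair_graph\<close>: an undirected edge \<open>{u, v}\<close> is the pair of arcs
  \<open>(u, v)\<close>, \<open>(v, u)\<close>. Hence \<open>cycle\<close> has to be restricted to length at least 3 (the walk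
  \<open>u, v, u\<close> is a directed cycle), and the library constants \<open>forest\<close> and \<open>tree\<close>, which only refer to
  directed cycles, are not the undirected notions.
\<close>

definition finite_tree :: "'a pair_pre_digraph \<Rightarrow> bool" where
  "finite_tree G \<longleftrightarrow> pair_graph G \<and> Digraph_Component.connected G \<and>
     \<not> (\<exists>p. pre_digraph.cycle G p \<and> 3 \<le> length p)"

text \<open>By symmetry of the arc set, the arcs leaving \<open>v\<close> correspond to the edges at \<open>v\<close>.\<close>

definition vertex_degree :: "'a pair_pre_digraph \<Rightarrow> 'a \<Rightarrow> nat" where
  "vertex_degree G v = out_degree G v"

definition graph_morphism :: "'a pair_pre_digraph \<Rightarrow> 'b pair_pre_digraph \<Rightarrow> ('a \<Rightarrow> 'b) \<Rightarrow> bool" where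
  "graph_morphism G H \<phi> \<longleftrightarrow> \<phi> \<in> pverts G \<rightarrow> pverts H \<and>
     (\<forall>u v. (u, v) \<in> parcs G \<longrightarrow> (\<phi> u, \<phi> v) \<in> parcs H)"


section \<open>Right-angled Coxeter groups\<close>

definition racg :: "'a pair_pre_digraph \<Rightarrow> 'a word set monoid" where
  "racg G = presented_group (pverts G)
     ({[(u, True), (u, True)] | u. u \<in> pverts G} \<union>
      {[(u, True), (v, True), (u, False), (v, False)] | u v. (u, v) \<in> parcs G})"

lemma group_racg: "group (racg G)"
  by (simp add: racg_def group_presented_group)

end

theory Submission
  imports Defs "HOL-Library.Transitive_Closure_Table"
begin

text \<open>
  In a right-angled Coxeter group over a triangle-free graph every involution is conjugate to a
  vertex \<open>s\<close> or to the product \<open>s t\<close> of two adjacent vertices. The centralizer of \<open>s\<close> is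
  \<open>\<langle>s\<rangle> \<times> \<langle>link s\<rangle>\<close>, a product with a free product of copies of \<open>\<int>/2\<close>, whereas that of \<open>s t\<close> is
  finite. So an embedding sends a vertex \<open>u\<close> of degree at least 2 to a conjugate of a single vertex
  \<open>\<phi> u\<close>, and comparing \<open>\<langle>link u\<rangle>\<close> with \<open>\<langle>link (\<phi> u)\<rangle>\<close> yields the degree conditions; leaves can be mapped
  to arbitrary neighbours.

  Conversely, a morphism \<open>\<phi>\<close> is turned into an embedding \<open>u \<mapsto> g u (\<phi> u) (g u)\<inverse>\<close>. The conjugators
  are propagated along the edges of \<open>R\<close> such that the reflections attached to the neighbours of \<open>u\<close>
  generate a free product in the free product \<open>\<langle>link (\<phi> u)\<rangle>\<close>, which is where the degree conditions enter.
  The half-spaces of the reflections are then disjoint for distinct non-adjacent vertices, and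
  injectivity follows by ping-pong.
\<close>

section \<open>Words over the generators\<close>

text \<open>The thresholds 2 and 3 come from the free product of n copies of the group of order 2.
  It is finite for n <= 1 and infinite dihedral, hence virtually abelian, for n = 2; for n >= 3 it
  contains free products of any finite number of such copies, so degrees above 3 need not be told
  apart. Sending \<open>u\<close> to \<open>\<phi> u\<close> itself fails as soon as
  \<open>\<phi>\<close> identifies two neighbours of a vertex: the conjugators have to separate such
  neighbours. The source being a tree, they can be propagated without any compatibility condition
  around a cycle; in the target, the absence of triangles and squares keeps descents belonging to
  different vertices from interfering. In the other direction the leaves are the obstacle: the image
  of a leaf may be conjugate to a product of two adjacent generators, and then it singles out no
  vertex. The arguments are carried out on words. Their main tool is the set of left descents of a
  group element, which first has to be shown independent of the representing word.\<close>

inductive racg_eq :: "('a \<Rightarrow> 'a \<Rightarrow> bool) \<Rightarrow> 'a list \<Rightarrow> 'a list \<Rightarrow> bool" for A where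
  refl: "racg_eq A w w"
| cancel: "racg_eq A (u @ [s, s] @ v) (u @ v)"
| swap: "A s t \<Longrightarrow> racg_eq A (u @ [s, t] @ v) (u @ [t, s] @ v)"
| sym: "racg_eq A v w \<Longrightarrow> racg_eq A w v"
| trans: "racg_eq A u v \<Longrightarrow> racg_eq A v w \<Longrightarrow> racg_eq A u w"

locale simple_graph =
  fixes A :: "'a \<Rightarrow> 'a \<Rightarrow> bool"
  assumes adj_sym: "A s t \<Longrightarrow> A t s"
    and adj_irrefl: "\<not> A s s"
begin

abbreviation word_eq (infix \<open>\<approx>\<close> 50) where "w \<approx> w' \<equiv> racg_eq A w w'"

lemma eq_refl [simp]: "w \<approx> w"
  by (rule racg_eq.refl)

lemma eq_sym: "v \<approx> w \<Longrightarrow> w \<approx> v"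
  by (rule racg_eq.sym)

lemma eq_trans [trans]: "u \<approx> v \<Longrightarrow> v \<approx> w \<Longrightarrow> u \<approx> w"
  by (rule racg_eq.trans)

lemma eq_context: "v \<approx> w \<Longrightarrow> p @ v @ q \<approx> p @ w @ q"
proof (induction rule: racg_eq.induct)
  case (cancel u s v)
  show ?case using racg_eq.cancel[of A "p @ u" s "v @ q"] by simp
next
  case (swap s t u v)
  show ?case using racg_eq.swap[of A s t "p @ u" "v @ q", OF swap] by simp
qed (auto intro: racg_eq.intros)

lemma eq_append: "v \<approx> v' \<Longrightarrow> w \<approx> w' \<Longrightarrow> v @ w \<approx> v' @ w'"
  using eq_context[of v v' "[]" w] eq_context[of w w' v' "[]"] eq_trans by simp

lemma eq_Cons: "w \<approx> w' \<Longrightarrow> s # w \<approx> s # w'"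
  using eq_append[of "[s]" "[s]"] by simp

lemma eq_cancel: "s # s # w \<approx> w"
  using racg_eq.cancel[of A "[]" s w] by simp

lemma eq_swap: "A s t \<Longrightarrow> s # t # w \<approx> t # s # w"
  using racg_eq.swap[of A s t "[]" w] by simp

lemma eq_rev: "v \<approx> w \<Longrightarrow> rev v \<approx> rev w"
proof (induction rule: racg_eq.induct)
  case (cancel u s v)
  show ?case using racg_eq.cancel[of A "rev v" s "rev u"] by simp
next
  case (swap s t u v)
  show ?case using racg_eq.swap[of A t s "rev v" "rev u"] adj_sym[OF swap] by simp
qed (auto intro: racg_eq.intros)

lemma rev_append_eq: "rev w @ w \<approx> []"
proof (induction w)
  case (Cons s w)
  have "rev w @ [s, s] @ w \<approx> rev w @ w" by (rule racg_eq.cancel)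
  also note Cons
  finally show ?case by simp
qed simp

lemma append_rev_eq: "w @ rev w \<approx> []"
  using rev_append_eq[of "rev w"] by simp

lemma rev_append_left: "rev w @ w @ v \<approx> v"
  using eq_append[OF rev_append_eq eq_refl, of w v] by simp

lemma append_rev_left: "w @ rev w @ v \<approx> v"
  using rev_append_left[of "rev w" v] by simp

lemma eq_left_cancel: "u @ v \<approx> u @ w \<Longrightarrow> v \<approx> w"
  using eq_append[OF eq_refl, of "u @ v" "u @ w" "rev u"] rev_append_left eq_trans eq_sym by metis

lemma eq_Cons_move: "s # v \<approx> w \<longleftrightarrow> v \<approx> s # w"
  by (metis eq_Cons eq_cancel eq_sym eq_trans)

lemma eq_append_move: "u @ v \<approx> w \<longleftrightarrow> v \<approx> rev u @ w"
  by (metis append_rev_left rev_append_left eq_append eq_refl eq_sym eq_trans append_assoc)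

section \<open>Left descents\<close>

text \<open>
  A state stores, for every independent set \<open>c\<close> of vertices, the subword of a reduced word formed
  by the letters in \<open>c\<close>; the letter \<open>s\<close> can be shuffled to the front of the word iff it heads the
  entry of every \<open>c\<close> that contains \<open>s\<close>.
\<close>

definition comps :: "'a \<Rightarrow> 'a set set" where
  "comps s = {c. s \<in> c \<and> (\<forall>p\<in>c. \<forall>q\<in>c. \<not> A p q)}"

definition heads :: "'a \<Rightarrow> ('a set \<Rightarrow> 'a list) \<Rightarrow> bool" where
  "heads s x \<longleftrightarrow> (\<forall>c \<in> comps s. \<exists>l. x c = s # l)"

definition add :: "'a \<Rightarrow> ('a set \<Rightarrow> 'a list) \<Rightarrow> 'a set \<Rightarrow> 'a list" where
  "add s x = (\<lambda>c. if c \<in> comps s then s # x c else x c)"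

definition remove :: "'a \<Rightarrow> ('a set \<Rightarrow> 'a list) \<Rightarrow> 'a set \<Rightarrow> 'a list" where
  "remove s x = (\<lambda>c. if c \<in> comps s then tl (x c) else x c)"

definition push :: "'a \<Rightarrow> ('a set \<Rightarrow> 'a list) \<Rightarrow> 'a set \<Rightarrow> 'a list" where
  "push s x = (if heads s x then remove s x else add s x)"

text \<open>For an arbitrary function, \<open>s\<close> may still head every entry after it has been
  removed, and then \<open>push s\<close> is not an involution. Never adding a letter that already
  heads excludes this.\<close>

inductive valid :: "('a set \<Rightarrow> 'a list) \<Rightarrow> bool" where
  empty: "valid (\<lambda>_. [])"
| add: "valid x \<Longrightarrow> \<not> heads s x \<Longrightarrow> valid (add s x)"

lemma comps_adj: "A s t \<Longrightarrow> c \<in> comps s \<Longrightarrow> c \<notin> comps t"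
  by (auto simp: comps_def)

lemma comps_self: "{s} \<in> comps s"
  by (auto simp: comps_def adj_irrefl)

lemma comps_nonadj: "\<not> A s t \<Longrightarrow> {s, t} \<in> comps s \<inter> comps t"
  by (auto simp: comps_def adj_irrefl dest: adj_sym)

lemma heads_add_self [simp]: "heads s (add s x)"
  by (auto simp: heads_def add_def)

lemma remove_add [simp]: "remove s (add s x) = x"
  by (auto simp: remove_def add_def)

lemma add_remove: "heads s x \<Longrightarrow> add s (remove s x) = x"
  by (fastforce simp: remove_def add_def heads_def)

lemma heads_add_adj: "A s t \<Longrightarrow> heads s (add t x) = heads s x"
  by (auto simp: heads_def add_def dest: comps_adj)

lemma heads_remove_adj: "A s t \<Longrightarrow> heads s (remove t x) = heads s x"
  by (auto simp: heads_def remove_def dest: comps_adj)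

lemma heads_unique: "heads s x \<Longrightarrow> heads t x \<Longrightarrow> s \<noteq> t \<Longrightarrow> A s t"
  using comps_nonadj[of s t] by (fastforce simp: heads_def)

lemma remove_add_adj: "A s t \<Longrightarrow> remove s (add t x) = add t (remove s x)"
  by (auto simp: remove_def add_def fun_eq_iff dest: comps_adj)

lemma valid_remove:
  "valid x \<Longrightarrow> heads s x \<Longrightarrow> valid (remove s x) \<and> \<not> heads s (remove s x)"
proof (induction rule: valid.induct)
  case empty
  then show ?case using comps_self by (auto simp: heads_def)
next
  case (add x t)
  show ?case
  proof (cases "s = t")
    case True
    then show ?thesis using add by simp
  next
    case False
    \<comment> \<open>Both letters head the state, so they are adjacent and act on disjoint sets of
      entries; removing \<open>s\<close> therefore passes under the addition of
      \<open>t\<close>.\<close>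
    then have st: "A s t" using add.prems heads_unique heads_add_self by blast
    then have "heads s x" using add.prems heads_add_adj by blast
    then show ?thesis
      using st add valid.add heads_remove_adj[OF adj_sym] heads_add_adj remove_add_adj by auto
  qed
qed

lemma valid_push: "valid x \<Longrightarrow> valid (push s x)"
  using valid_remove valid.add by (auto simp: push_def)

lemma push_push: "valid x \<Longrightarrow> push s (push s x) = x"
  using valid_remove add_remove by (auto simp: push_def)

lemma push_commute: "A s t \<Longrightarrow> push s (push t x) = push t (push s x)"
  using comps_adj[of s t]
  by (auto simp: push_def heads_add_adj heads_remove_adj adj_sym)
    (auto simp: add_def remove_def fun_eq_iff)

definition state :: "'a list \<Rightarrow> 'a set \<Rightarrow> 'a list" where
  "state w = foldr push w (\<lambda>_. [])"

lemma state_Cons [simp]: "state (s # w) = push s (state w)"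
  by (simp add: state_def)

lemma valid_state: "valid (state w)"
  by (induction w) (auto simp: state_def intro: valid.empty valid_push)

text \<open>The pushes satisfy the Coxeter relations on valid states, so the group acts on these
  states. This makes descents well defined without a confluence argument for cancellations and
  swaps.\<close>

lemma state_cong: "v \<approx> w \<Longrightarrow> state v = state w"
proof (induction rule: racg_eq.induct)
  case (cancel u s v)
  show ?case using push_push[OF valid_state, of s v] by (simp add: state_def)
next
  case (swap s t u v)
  show ?case using push_commute[OF swap, of "state v"] by (simp add: state_def)
qed auto

definition desc :: "'a \<Rightarrow> 'a list \<Rightarrow> bool" where
  "desc s w \<longleftrightarrow> heads s (state w)"

lemma desc_cong: "v \<approx> w \<Longrightarrow> desc s v = desc s w"
  using state_cong by (auto simp: desc_def)

lemma desc_Nil [simp]: "\<not> desc s []"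
  using comps_self by (auto simp: desc_def state_def heads_def)

lemma desc_Cons [simp]: "desc s (s # w) \<longleftrightarrow> \<not> desc s w"
  using valid_remove[OF valid_state, of s w] by (auto simp: desc_def push_def)

lemma desc_Cons_adj: "A s t \<Longrightarrow> desc s (t # w) \<longleftrightarrow> desc s w"
  by (auto simp: desc_def push_def heads_add_adj heads_remove_adj)

lemma desc_unique: "desc s w \<Longrightarrow> desc t w \<Longrightarrow> s \<noteq> t \<Longrightarrow> A s t"
  using heads_unique by (auto simp: desc_def)

lemma desc_append_link: "\<forall>t\<in>set u. A s t \<Longrightarrow> desc s (u @ w) \<longleftrightarrow> desc s w"
  by (induction u) (auto simp: desc_Cons_adj)

text \<open>Ping-pong in a free product: two distinct descents must be adjacent, so once the head of
  the tail is a descent, the next letter in front of it is not one, and prepending makes it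
  one.\<close>

lemma desc_alternating:
  assumes "u \<noteq> []" "distinct_adj u" "\<And>s t. s \<in> set u \<Longrightarrow> t \<in> set u \<Longrightarrow> \<not> A s t" "\<not> desc (last u) w"
  shows "desc (hd u) (u @ w)"
  using assms
proof (induction u)
  case (Cons s u)
  show ?case
  proof (cases "u = []")
    case False
    then have "desc (hd u) (u @ w)" using Cons by (cases u) auto
    moreover have "s \<noteq> hd u" "\<not> A s (hd u)" using Cons.prems False by (cases u; auto)+
    ultimately show ?thesis using desc_unique by fastforce
  qed (use Cons in auto)
qed simp

section \<open>Reduced words and word length\<close>

fun reduced :: "'a list \<Rightarrow> bool" where
  "reduced [] = True"
| "reduced (s # w) \<longleftrightarrow> reduced w \<and> \<not> desc s w"

text \<open>A descent either is the first letter or commutes with it; in the second case the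
  induction hypothesis brings it to the front of the tail, and one swap finishes.\<close>

lemma reduced_desc:
  "reduced w \<Longrightarrow> desc s w \<Longrightarrow>
    \<exists>w'. reduced w' \<and> w \<approx> s # w' \<and> length w = Suc (length w') \<and> set w' \<subseteq> set w"
proof (induction w)
  case (Cons t w)
  show ?case
  proof (cases "s = t")
    case True
    then show ?thesis using Cons.prems by auto
  next
    case False
    then have st: "A s t" using Cons.prems desc_unique desc_Cons by (metis reduced.simps(2))
    then have "desc s w" using Cons.prems desc_Cons_adj by blast
    then obtain w' where w': "reduced w'" "w \<approx> s # w'" "length w = Suc (length w')" "set w' \<subseteq> set w"
      using Cons by auto
    have "\<not> desc t w'"
      using Cons.prems(1) desc_cong[OF w'(2), of t] desc_Cons_adj[OF adj_sym[OF st]] by simp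
    moreover have "t # w \<approx> s # t # w'"
      using eq_Cons[OF w'(2), of t] eq_swap[OF adj_sym[OF st]] eq_trans by blast
    ultimately show ?thesis using w' by (intro exI[of _ "t # w'"]) auto
  qed
qed simp

lemma reduced_exists: "\<exists>w'. reduced w' \<and> w \<approx> w' \<and> length w' \<le> length w \<and> set w' \<subseteq> set w"
proof (induction w)
  case (Cons s w)
  then obtain w' where w': "reduced w'" "w \<approx> w'" "length w' \<le> length w" "set w' \<subseteq> set w" by auto
  show ?case
  proof (cases "desc s w'")
    case True
    then obtain v where v: "reduced v" "w' \<approx> s # v" "length w' = Suc (length v)" "set v \<subseteq> set w'"
      using reduced_desc[OF w'(1)] by blast
    have "s # w \<approx> v" using eq_trans[OF w'(2) v(2)] eq_Cons_move by (metis eq_sym)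
    then show ?thesis using v w' by (intro exI[of _ v]) auto
  next
    case False
    then show ?thesis using w' eq_Cons by (intro exI[of _ "s # w'"]) auto
  qed
qed auto

lemma reduced_length_eq: "reduced v \<Longrightarrow> reduced w \<Longrightarrow> v \<approx> w \<Longrightarrow> length v = length w"
proof (induction v arbitrary: w)
  case Nil
  then show ?case using desc_cong[OF Nil(3), of "hd w"] by (cases w) auto
next
  case (Cons s v)
  have "desc s w" using Cons.prems desc_cong[OF Cons.prems(3), of s] by simp
  then obtain w' where w': "reduced w'" "w \<approx> s # w'" "length w = Suc (length w')"
    using reduced_desc Cons.prems by blast
  have "v \<approx> w'" using eq_trans[OF Cons.prems(3) w'(2)] eq_left_cancel[of "[s]" v w'] by simp
  then show ?case using Cons w' by auto
qed

lemma reduced_nonempty: "reduced w \<Longrightarrow> w \<approx> [] \<Longrightarrow> w = []"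
  using reduced_length_eq[of w "[]"] by simp

definition len :: "'a list \<Rightarrow> nat" where
  "len w = (LEAST n. \<exists>w'. w \<approx> w' \<and> length w' = n)"

lemma len_le: "w \<approx> w' \<Longrightarrow> len w \<le> length w'"
  unfolding len_def by (rule Least_le) blast

lemma len_reduced: "reduced w' \<Longrightarrow> w \<approx> w' \<Longrightarrow> len w = length w'"
proof (rule antisym[OF len_le])
  assume w': "reduced w'" "w \<approx> w'"
  obtain v where v: "w \<approx> v" "length v = len w"
    using LeastI_ex[of "\<lambda>n. \<exists>w'. w \<approx> w' \<and> length w' = n"] eq_refl unfolding len_def by blast
  obtain u where u: "reduced u" "v \<approx> u" "length u \<le> length v"
    using reduced_exists by blast
  have "length u = length w'"
    using reduced_length_eq[OF u(1) w'(1)] v u w' by (meson eq_sym eq_trans)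
  then show "length w' \<le> len w" using u v by simp
qed

lemma len_cong: "v \<approx> w \<Longrightarrow> len v = len w"
  using reduced_exists[of w] len_reduced eq_trans by metis

lemma len_append_le: "len (v @ w) \<le> len v + len w"
  using reduced_exists[of w] reduced_exists[of v] len_reduced
    len_le[OF eq_append] by (metis length_append)

lemma len_Cons: "len (s # w) = (if desc s w then len w - 1 else Suc (len w))"
  and len_desc: "desc s w \<Longrightarrow> 0 < len w"
proof -
  obtain v where v: "reduced v" "w \<approx> v" using reduced_exists by blast
  have "len (s # w) = len w - 1 \<and> 0 < len w" if d: "desc s w"
  proof -
    obtain u where u: "reduced u" "v \<approx> s # u" "length v = Suc (length u)"
      using reduced_desc[OF v(1)] d desc_cong[OF v(2)] by blast
    have "s # w \<approx> u" using v u by (meson eq_Cons_move eq_trans)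
    then show ?thesis using len_reduced[OF u(1)] len_reduced[OF v] u by simp
  qed
  moreover have "len (s # w) = Suc (len w)" if d: "\<not> desc s w"
    using len_reduced[of "s # v" "s # w"] len_reduced[OF v] eq_Cons[OF v(2)] v(1) d desc_cong[OF v(2)]
    by simp
  ultimately show "len (s # w) = (if desc s w then len w - 1 else Suc (len w))"
    "desc s w \<Longrightarrow> 0 < len w"
    by auto
qed

lemma desc_iff_len: "desc s w \<longleftrightarrow> len (s # w) < len w"
  using len_Cons[of s w] len_desc[of s w] by auto

lemma len_rev_le: "len (rev w) \<le> len w"
proof -
  obtain v where v: "reduced v" "w \<approx> v" using reduced_exists by blast
  show ?thesis using len_le[OF eq_rev[OF v(2)]] len_reduced[OF v] by simp
qed

lemma len_rev [simp]: "len (rev w) = len w"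
  using len_rev_le[of w] len_rev_le[of "rev w"] by simp

lemma len_snoc: "len (w @ [s]) = len (s # rev w)"
  using len_rev[of "w @ [s]"] by simp

lemma desc_exists: "\<not> w \<approx> [] \<Longrightarrow> \<exists>s. desc s w"
proof -
  assume w: "\<not> w \<approx> []"
  obtain v where v: "reduced v" "w \<approx> v" using reduced_exists by blast
  with w obtain s v' where "v = s # v'" by (cases v) auto
  then show ?thesis using v desc_cong[OF v(2), of s] by auto
qed

end

context simple_graph
begin

section \<open>Involutions and centralizers\<close>

lemma len_append_le_length: "len (v @ w) \<le> len v + length w"
  using len_append_le[of v w] len_le[of w w] by simp

lemma desc_append: "desc t y \<Longrightarrow> len (y @ z) = len y + length z \<Longrightarrow> desc t (y @ z)"
  using len_append_le_length[of "t # y" z] by (simp add: desc_iff_len)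

text \<open>A form of the folding condition for Coxeter groups: if appending \<open>t\<close>
  creates the descent \<open>s\<close>, the new letter itself must have travelled to the
  front.\<close>

lemma snoc_exchange_reduced: "reduced y \<Longrightarrow> \<not> desc s y \<Longrightarrow> desc s (y @ [t]) \<Longrightarrow> s # y \<approx> y @ [t]"
proof (induction y arbitrary: s)
  case Nil
  then show ?case using desc_unique[of s "[t]" t] desc_Cons_adj[of s t "[]"] by (cases "s = t") auto
next
  case (Cons p y)
  have ps: "p \<noteq> s" using Cons.prems by auto
  show ?case
  proof (cases "A s p")
    case True
    then have "s # y \<approx> y @ [t]" using Cons desc_Cons_adj by auto
    then have "p # s # y \<approx> p # y @ [t]" by (rule eq_Cons)
    then show ?thesis using eq_swap[OF True, of y] eq_trans by simp
  next
    case False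
    \<comment> \<open>As \<open>s\<close> and \<open>p\<close> cannot both be descents, the
      induction hypothesis for \<open>p\<close> yields \<open>p y = y t\<close>. Then
      \<open>y = p y t\<close> has the descent \<open>s\<close>, hence so has
      \<open>y t = p y\<close>, a contradiction.\<close>
    then have "\<not> desc p (p # y @ [t])" using Cons.prems desc_unique ps by (metis append_Cons)
    then have py: "p # y \<approx> y @ [t]" using Cons by auto
    then have "y \<approx> p # y @ [t]" by (simp add: eq_Cons_move)
    then have "desc s y" using Cons.prems desc_cong by fastforce
    moreover have "len (y @ [t]) = Suc (len y)"
      using len_cong[OF py] len_Cons[of p y] Cons.prems by simp
    ultimately have "desc s (y @ [t])" by (intro desc_append) auto
    then show ?thesis using desc_cong[OF py] Cons.prems by auto
  qed
qed

lemma snoc_exchange: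
  assumes "\<not> desc s y" "desc s (y @ [t])"
  shows "s # y \<approx> y @ [t]"
proof -
  obtain v where v: "reduced v" "y \<approx> v" using reduced_exists by blast
  have "s # v \<approx> v @ [t]"
    using assms desc_cong[OF v(2)] desc_cong[OF eq_append[OF v(2) eq_refl]]
    by (intro snoc_exchange_reduced v) auto
  then show ?thesis using v(2) by (meson eq_Cons eq_append eq_refl eq_sym eq_trans)
qed

text \<open>If \<open>s\<close> is not a descent of \<open>y\<close>, it is one of
  \<open>s y = y s\<close>, where \<open>t\<close> stays a descent for reasons of length; distinct
  descents are adjacent.\<close>

lemma commuting_desc:
  assumes "s # y \<approx> y @ [s]" "desc t y" "t \<noteq> s"
  shows "A s t"
proof (cases "desc s y")
  case True
  then show ?thesis using assms desc_unique by blast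
next
  case False
  have len: "len (y @ [s]) = Suc (len y)" using len_cong[OF assms(1)] False len_Cons by simp
  have "desc s (y @ [s])" using desc_cong[OF assms(1), of s] False by simp
  moreover have "desc t (y @ [s])" using assms(2) len by (intro desc_append) auto
  ultimately show ?thesis using assms(3) desc_unique by blast
qed

lemma commute_append: "u @ w \<approx> w @ u \<Longrightarrow> v @ w \<approx> w @ v \<Longrightarrow> (u @ v) @ w \<approx> w @ (u @ v)"
  using eq_context[of "v @ w" "w @ v" u "[]"] eq_context[of "u @ w" "w @ u" "[]" v] eq_trans by simp

lemma commute_letters:
  "\<forall>s\<in>set u. \<forall>t\<in>set v. A s t \<or> s = t \<Longrightarrow> u @ v \<approx> v @ u"
proof (induction u)
  case (Cons s u)
  have "[s] @ v \<approx> v @ [s]" using Cons.prems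
  proof (induction v)
    case (Cons t v)
    have "s # t # v \<approx> t # s # v" using Cons.prems eq_swap by auto
    also have "t # s # v \<approx> t # v @ [s]" using Cons by (intro eq_Cons) auto
    finally show ?case by simp
  qed simp
  then show ?case using commute_append[of "[s]" v u] Cons by auto
qed simp

lemma square_clique_word: "\<forall>s\<in>set w. \<forall>t\<in>set w. A s t \<or> s = t \<Longrightarrow> w @ w \<approx> []"
proof (induction w)
  case (Cons s w)
  have "w @ [s] \<approx> [s] @ w" using Cons.prems by (intro commute_letters) auto
  from eq_context[OF this, of "[s]" w] have "s # w @ s # w \<approx> s # s # w @ w" by simp
  also have "s # s # w @ w \<approx> w @ w" by (rule eq_cancel)
  also have "w @ w \<approx> []" using Cons by auto
  finally show ?case by simp
qed simp

lemma star_word_split: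
  "\<forall>t\<in>set w. A s t \<or> t = s \<Longrightarrow> w \<approx> filter (\<lambda>t. t \<noteq> s) w @ filter (\<lambda>t. t = s) w"
proof (induction w)
  case (Cons t w)
  let ?v = "filter (\<lambda>t. t \<noteq> s) w" and ?e = "filter (\<lambda>t. t = s) w"
  have w: "t # w \<approx> t # ?v @ ?e" using Cons by (intro eq_Cons) auto
  show ?case
  proof (cases "t = s")
    case True
    have "[s] @ ?v \<approx> ?v @ [s]" using Cons.prems by (intro commute_letters) auto
    from eq_context[OF this, of "[]" ?e] show ?thesis using True w eq_trans by simp
  qed (use w in simp)
qed simp

lemma star_word_square:
  assumes "\<forall>t\<in>set w. A s t \<or> t = s"
  shows "w @ w \<approx> filter (\<lambda>t. t \<noteq> s) w @ filter (\<lambda>t. t \<noteq> s) w"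
proof -
  let ?v = "filter (\<lambda>t. t \<noteq> s) w" and ?e = "filter (\<lambda>t. t = s) w"
  have "w @ w \<approx> (?v @ ?e) @ ?v @ ?e" using star_word_split[OF assms] by (intro eq_append)
  also have "(?v @ ?e) @ ?v @ ?e \<approx> ?v @ ?v @ ?e @ ?e"
    using eq_context[OF commute_letters[of ?e ?v], of ?v ?e] assms by auto
  also have "?v @ ?v @ ?e @ ?e \<approx> ?v @ ?v"
    using eq_append[OF eq_refl square_clique_word[of ?e], of "?v @ ?v"] by auto
  finally show ?thesis .
qed

text \<open>The parities of the letters give the image in the abelianization, which does not change
  under conjugation.\<close>

lemma odd_count_cong: "v \<approx> w \<Longrightarrow> odd (count_list v t) = odd (count_list w t)"
  by (induction rule: racg_eq.induct) auto

text \<open>Words of even length in two involutions represent rotations of a dihedral group, that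
  is, powers of \<open>p q\<close>.\<close>

lemma dihedral_even_words_commute:
  assumes "even (length u)" "even (length v)" "set u \<subseteq> {p, q}" "set v \<subseteq> {p, q}"
  shows "u @ v \<approx> v @ u"
proof -
  have pair: "[a, b, c, d] \<approx> [c, d, a, b]" if abcd: "{a, b, c, d} \<subseteq> {p, q}" for a b c d
  proof -
    have *: "[a, b, c, d] \<approx> [c, d, a, b]" if "a = b"
      using eq_cancel[of a "[c, d]"] eq_context[OF eq_cancel[of a "[]"], of "[c, d]" "[]"] that
      by (simp, meson eq_sym eq_trans)
    have **: "[a, b, c, d] \<approx> [c, d, a, b]" if "c = d"
      using eq_cancel[of c "[a, b]"] eq_context[OF eq_cancel[of c "[]"], of "[a, b]" "[]"] that
      by (simp, meson eq_sym eq_trans)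
    have ***: "[a, b, b, a] \<approx> [b, a, a, b]"
      using append_rev_eq[of "[a, b]"] append_rev_eq[of "[b, a]"] by (simp, meson eq_sym eq_trans)
    consider "a = b" | "c = d" | "a = c" "b = d" | "a = d" "b = c" using abcd by auto
    then show ?thesis using * ** *** by cases auto
  qed
  have two: "[a, b] @ v \<approx> v @ [a, b]" if "{a, b} \<subseteq> {p, q}" for a b
    using assms(2,4)
  proof (induction v rule: induct_list012)
    case (3 c d v)
    have "[c, d] @ [a, b] \<approx> [a, b] @ [c, d]" using pair[of c d a b] 3 that by auto
    then have "([c, d] @ v) @ [a, b] \<approx> [a, b] @ ([c, d] @ v)"
      using 3 by (intro commute_append) (auto intro: eq_sym)
    then show ?case using eq_sym by simp
  qed auto
  show ?thesis using assms(1,3)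
  proof (induction u rule: induct_list012)
    case (3 a b u)
    then show ?case using commute_append[of "[a, b]" v u] two[of a b] by auto
  qed auto
qed

text \<open>Every descent of \<open>y\<close> commutes with \<open>s\<close>, so it can be split
  off: the rest still commutes with \<open>s\<close> and is shorter.\<close>

lemma centralizer:
  assumes "s # y \<approx> y @ [s]"
  shows "\<exists>y'. y \<approx> y' \<and> (\<forall>t\<in>set y'. A s t \<or> t = s)"
  using assms
proof (induction "len y" arbitrary: y rule: less_induct)
  case less
  show ?case
  proof (cases "y \<approx> []")
    case False
    then obtain t where t: "desc t y" using desc_exists by blast
    have st: "A s t \<or> t = s" using less.prems t commuting_desc by blast
    have "[s] @ [t] \<approx> [t] @ [s]" using st by (intro commute_letters) auto
    then have "[s] @ t # y \<approx> (t # y) @ [s]"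
      using less.prems commute_append[of "[t]" "[s]" y] eq_sym by auto
    then obtain y' where y': "t # y \<approx> y'" "\<forall>t\<in>set y'. A s t \<or> t = s"
      using less.hyps[of "t # y"] t by (auto simp: desc_iff_len)
    then have "y \<approx> t # y'" by (simp add: eq_Cons_move)
    then show ?thesis using y' st by (intro exI[of _ "t # y'"]) auto
  qed (auto intro!: exI[of _ "[]"])
qed

lemma conj_eq_self_iff: "u @ x @ rev u \<approx> v \<longleftrightarrow> x \<approx> rev u @ v @ u"
proof -
  have "u @ x @ rev u \<approx> v \<longleftrightarrow> x @ rev u \<approx> rev u @ v" by (rule eq_append_move)
  also have "\<dots> \<longleftrightarrow> u @ rev x \<approx> rev v @ u"
    using eq_rev[of "x @ rev u" "rev u @ v"] eq_rev[of "u @ rev x" "rev v @ u"] by auto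
  also have "\<dots> \<longleftrightarrow> rev x \<approx> rev u @ rev v @ u" by (rule eq_append_move)
  also have "\<dots> \<longleftrightarrow> x \<approx> rev u @ v @ u"
    using eq_rev[of "rev x" "rev u @ rev v @ u"] eq_rev[of x "rev u @ v @ u"] by auto
  finally show ?thesis .
qed

lemma eq_conj: "x \<approx> y \<Longrightarrow> g @ x @ rev g \<approx> g @ y @ rev g"
  by (rule eq_context)

lemma conj_append: "(g @ x @ rev g) @ (g @ y @ rev g) \<approx> g @ (x @ y) @ rev g"
  using eq_append[OF eq_refl rev_append_left[of g "y @ rev g"], of "g @ x"] by simp

end

section \<open>Centralizers of edges and involutions without triangles\<close>

locale triangle_free_graph = simple_graph +
  assumes no_triangle: "A s t \<Longrightarrow> A t u \<Longrightarrow> \<not> A s u"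
begin

lemma centralizer_edge:
  assumes "A s t" "[s, t] @ y \<approx> y @ [s, t]"
  shows "\<exists>y'. y \<approx> y' \<and> set y' \<subseteq> {s, t}"
  using assms(2)
proof (induction "len y" arbitrary: y rule: less_induct)
  case less
  have step: ?case if p: "p \<in> {s, t}" "desc p y" for p
  proof -
    have "[s, t] @ [p] \<approx> [p] @ [s, t]"
      using p assms(1) adj_sym by (intro commute_letters) auto
    then have "[s, t] @ p # y \<approx> (p # y) @ [s, t]"
      using less.prems commute_append[of "[p]" "[s, t]" y] eq_sym by auto
    then obtain y' where y': "p # y \<approx> y'" "set y' \<subseteq> {s, t}"
      using less.hyps[of "p # y"] p by (auto simp: desc_iff_len)
    then have "y \<approx> p # y'" by (simp add: eq_Cons_move)
    then show ?thesis using y' p by (intro exI[of _ "p # y'"]) auto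
  qed
  show ?case
  proof (cases "desc s y \<or> desc t y \<or> y \<approx> []")
    case True
    moreover have "\<exists>y'. y \<approx> y' \<and> set y' \<subseteq> {s, t}" if "y \<approx> []"
      using that by (intro exI[of _ "[]"]) simp
    ultimately show ?thesis using step[of s] step[of t] by blast
  next
    case False
    then obtain p where p: "desc p y" using desc_exists by blast
    \<comment> \<open>When neither \<open>s\<close> nor \<open>t\<close> is a descent of
      \<open>y\<close>, no cancellation occurs in \<open>s t y = y s t\<close>, so \<open>p\<close>
      is a descent of it besides \<open>s\<close> and \<open>t\<close>: a triangle.\<close>
    have st: "desc s (s # t # y)" "desc t (s # t # y)"
      using False assms(1) adj_sym desc_Cons_adj by auto
    have "len (y @ [s, t]) = len y + 2"
      using len_cong[OF less.prems] st False by (simp add: len_Cons)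
    then have "desc p (y @ [s, t])" using p by (intro desc_append) auto
    then have "desc p (s # t # y)" using desc_cong[OF less.prems] by simp
    then have "A p s" "A p t" using st False p desc_unique by metis+
    then show ?thesis using no_triangle[of s p t] adj_sym assms(1) by blast
  qed
qed

text \<open>A descent that does not commute with \<open>x\<close> conjugates \<open>x\<close> to a
  shorter involution. If all descents commute with \<open>x\<close>, splitting off at most two of
  them exhausts \<open>x\<close>, because a third one would complete a triangle.\<close>

lemma involution_cases:
  assumes "x @ x \<approx> []" "\<not> x \<approx> []"
  shows "(\<exists>g s. x \<approx> g @ [s] @ rev g) \<or> (\<exists>g s t. A s t \<and> x \<approx> g @ [s, t] @ rev g)"
  using assms
proof (induction "len x" arbitrary: x rule: less_induct)
  case less
  have x_rev: "x \<approx> rev x" using less.prems(1) eq_append_move[of x x "[]"] by simp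
  show ?case
  proof (cases "\<exists>s. desc s x \<and> \<not> s # x \<approx> x @ [s]")
    case True
    then obtain s where s: "desc s x" "\<not> s # x \<approx> x @ [s]" by blast
    define y where "y = s # x"
    have len_y: "Suc (len y) = len x" using s(1) len_Cons[of s x] len_desc by (simp add: y_def)
    have ny: "\<not> desc s y" using s(1) by (simp add: y_def)
    have "\<not> s # y \<approx> y @ [s]"
      using s(2) eq_left_cancel[of "[s]" "s # x" "x @ [s]"] by (auto simp: y_def)
    then have nd: "\<not> desc s (y @ [s])" using snoc_exchange[OF ny] by blast
    have "len (s # y @ [s]) = len (x @ [s])" by (intro len_cong) (simp add: y_def eq_cancel)
    also have "\<dots> = len (s # x)" using len_snoc len_cong[OF eq_Cons[OF x_rev]] by simp
    finally have "len (y @ [s]) < len x" using nd len_Cons[of s "y @ [s]"] len_y by (simp add: y_def)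
    moreover have "(y @ [s]) @ (y @ [s]) \<approx> []"
    proof -
      have "(y @ [s]) @ (y @ [s]) \<approx> [s] @ (x @ x) @ rev [s]"
        using conj_append[of "[s]" x x] by (simp add: y_def)
      also have "[s] @ (x @ x) @ rev [s] \<approx> [s] @ [] @ rev [s]" using less.prems(1) by (rule eq_conj)
      also have "[s] @ [] @ rev [s] \<approx> []" using eq_cancel[of s "[]"] by simp
      finally show ?thesis .
    qed
    moreover have x_conj: "x \<approx> [s] @ v @ rev [s]" if "y @ [s] \<approx> v" for v
      using conj_eq_self_iff[of "[s]" x v] that by (simp add: y_def)
    moreover have "\<not> y @ [s] \<approx> []"
      using x_conj[of "[]"] less.prems(2) eq_cancel[of s "[]"] eq_trans by auto
    ultimately have "(\<exists>g p. y @ [s] \<approx> g @ [p] @ rev g) \<or>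
        (\<exists>g p t. A p t \<and> y @ [s] \<approx> g @ [p, t] @ rev g)"
      using less.hyps by blast
    moreover have "x \<approx> (s # g) @ v @ rev (s # g)" if "y @ [s] \<approx> g @ v @ rev g" for g v
      using x_conj[OF that] by simp
    ultimately show ?thesis by blast
  next
    case False
    then have comm: "s # x \<approx> x @ [s]" if "desc s x" for s using that by blast
    obtain s where s: "desc s x" using desc_exists less.prems by blast
    define y where "y = s # x"
    have x: "x \<approx> s # y" using eq_sym[OF eq_cancel] by (simp add: y_def)
    have ny: "\<not> desc s y" using s by (simp add: y_def)
    have y_comm: "p # y \<approx> y @ [p]" if "desc p x" for p
    proof -
      have "A s p \<or> s = p" using that s desc_unique by blast
      then have "[s] @ [p] \<approx> [p] @ [s]" by (intro commute_letters) auto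
      then show ?thesis using commute_append[of "[s]" "[p]" x] comm[OF that] eq_sym
        by (simp add: y_def)
    qed
    show ?thesis
    proof (cases "y \<approx> []")
      case True
      then have "x \<approx> [] @ [s] @ rev []" using eq_trans[OF x eq_Cons] by auto
      then show ?thesis by blast
    next
      case False
      then obtain t where t: "desc t y" using desc_exists by blast
      have "t \<noteq> s" using t ny by blast
      then have st: "A s t" using commuting_desc y_comm s t by blast
      have tx: "desc t x" using desc_cong[OF x, of t] t desc_Cons_adj[OF adj_sym[OF st]] by simp
      define z where "z = t # y"
      have z_comm: "p # z \<approx> z @ [p]" if "p = s \<or> p = t" for p
      proof -
        have "[t] @ [p] \<approx> [p] @ [t]" using that st adj_sym by (intro commute_letters) auto
        then show ?thesis
          using commute_append[of "[t]" "[p]" y] y_comm that s tx eq_sym by (auto simp: z_def)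
      qed
      have nz: "\<not> desc s z" "\<not> desc t z"
        using ny t desc_Cons_adj[OF st] by (auto simp: z_def)
      have y: "y \<approx> t # z" using eq_sym[OF eq_cancel] by (simp add: z_def)
      have "z \<approx> []"
      proof (rule ccontr)
        assume "\<not> z \<approx> []"
        then obtain p where p: "desc p z" using desc_exists by blast
        then have "p \<noteq> s" "p \<noteq> t" using nz by auto
        then have "A s p" "A t p" using commuting_desc z_comm p by blast+
        then show False using no_triangle[of s p t] adj_sym st by blast
      qed
      then have "y \<approx> [t]" using eq_trans[OF y eq_Cons] by simp
      then have "x \<approx> [] @ [s, t] @ rev []" using eq_trans[OF x eq_Cons] by simp
      then show ?thesis using st by blast
    qed
  qed
qed

end

section \<open>Alternating words and conjugates\<close>

context simple_graph
begin

lemma desc_single [simp]: "desc s [t] \<longleftrightarrow> s = t"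
  using desc_unique[of s "[t]" t] desc_Cons_adj[of s t "[]"] by auto

lemma reduced_alternating:
  assumes "distinct_adj w" "\<And>s t. s \<in> set w \<Longrightarrow> t \<in> set w \<Longrightarrow> \<not> A s t"
  shows "reduced w"
  using assms
proof (induction w)
  case (Cons s w)
  show ?case
  proof (cases w)
    case (Cons t v)
    have "desc t w" using desc_alternating[of w "[]"] Cons Cons.prems by auto
    then have "\<not> desc s w" using Cons Cons.prems desc_unique by fastforce
    then show ?thesis using Cons.IH Cons.prems Cons by auto
  qed simp
qed simp

lemma single_letter_word: "set e \<subseteq> {s} \<Longrightarrow> e \<approx> [] \<or> e \<approx> [s]"
proof (induction e)
  case (Cons t e)
  then have "t # e \<approx> [s] \<or> t # e \<approx> [s, s]" using eq_Cons[of e _ s] by auto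
  then show ?case using eq_cancel[of s "[]"] eq_trans by blast
qed simp

lemma conj_commute:
  assumes "X \<approx> g @ x @ rev g" "X @ Y \<approx> Y @ X"
  shows "x @ rev g @ Y @ g \<approx> (rev g @ Y @ g) @ x"
proof -
  have *: "rev g @ X @ g \<approx> x"
    using conj_eq_self_iff[of g x X] assms(1) eq_sym by blast
  have "x @ rev g @ Y @ g \<approx> (rev g @ X @ g) @ rev g @ Y @ g"
    using * eq_sym by (intro eq_append) auto
  also have "\<dots> \<approx> rev g @ (X @ Y) @ g" using conj_append[of "rev g" X Y] by simp
  also have "\<dots> \<approx> rev g @ (Y @ X) @ g" using assms(2) by (rule eq_context)
  also have "\<dots> \<approx> (rev g @ Y @ g) @ rev g @ X @ g"
    using eq_sym[OF conj_append[of "rev g" Y X]] by simp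
  also have "\<dots> \<approx> (rev g @ Y @ g) @ x" using * by (intro eq_append) auto
  finally show ?thesis .
qed

lemma conj_concat_map:
  "\<forall>v\<in>set w. f v \<approx> g @ y v @ rev g \<Longrightarrow> concat (map f w) \<approx> g @ concat (map y w) @ rev g"
proof (induction w)
  case Nil
  then show ?case using append_rev_eq eq_sym by simp
next
  case (Cons v w)
  then have "f v @ concat (map f w) \<approx> (g @ y v @ rev g) @ (g @ concat (map y w) @ rev g)"
    by (intro eq_append) auto
  also note conj_append
  finally show ?case by simp
qed

end

section \<open>The graph morphism of an embedding\<close>

locale racg_embedding = R: triangle_free_graph A + S: triangle_free_graph B
  for A :: "'a \<Rightarrow> 'a \<Rightarrow> bool" and B :: "'b \<Rightarrow> 'b \<Rightarrow> bool" +
  fixes V :: "'a set" and f :: "'a \<Rightarrow> 'b list"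
  assumes adj_V: "A u v \<Longrightarrow> u \<in> V"
    and embedding: "w \<in> lists V \<Longrightarrow> w' \<in> lists V \<Longrightarrow>
      racg_eq A w w' \<longleftrightarrow> racg_eq B (concat (map f w)) (concat (map f w'))"
begin

no_notation R.word_eq (infix \<open>\<approx>\<close> 50)
notation S.word_eq (infix \<open>\<approx>\<close> 50)

lemma adj_V2: "A u v \<Longrightarrow> v \<in> V"
  using adj_V R.adj_sym by blast

lemma image_involution: "u \<in> V \<Longrightarrow> f u @ f u \<approx> []"
  using embedding[of "[u, u]" "[]"] R.eq_cancel[of u "[]"] by simp

lemma reduced_image: "w \<in> lists V \<Longrightarrow> R.reduced w \<Longrightarrow> w \<noteq> [] \<Longrightarrow> \<not> concat (map f w) \<approx> []"
  using embedding[of w "[]"] R.reduced_nonempty by auto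

lemma image_nontrivial: "u \<in> V \<Longrightarrow> \<not> f u \<approx> []"
  using reduced_image[of "[u]"] by simp

lemma image_distinct: "u \<in> V \<Longrightarrow> v \<in> V \<Longrightarrow> u \<noteq> v \<Longrightarrow> \<not> f u \<approx> f v"
proof
  assume *: "u \<in> V" "v \<in> V" "u \<noteq> v" "f u \<approx> f v"
  have "f u @ f v \<approx> f v @ f v" using *(4) by (intro S.eq_append) auto
  then have "f u @ f v \<approx> []" using image_involution[OF *(2)] S.eq_trans by blast
  then show False using reduced_image[of "[u, v]"] * by simp
qed

lemma image_commute: "A u v \<Longrightarrow> f u @ f v \<approx> f v @ f u"
  using embedding[of "[u, v]" "[v, u]"] R.eq_swap[of u v "[]"] adj_V adj_V2 by simp

lemma image_cases:
  assumes "u \<in> V"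
  obtains g s where "f u \<approx> g @ [s] @ rev g" | g s t where "B s t" "f u \<approx> g @ [s, t] @ rev g"
  using S.involution_cases[OF image_involution image_nontrivial] assms by blast

lemma star_image:
  assumes "f u \<approx> g @ [s] @ rev g"
  obtains y where "\<And>v. A u v \<Longrightarrow> f v \<approx> g @ y v @ rev g"
    "\<And>v t. A u v \<Longrightarrow> t \<in> set (y v) \<Longrightarrow> B s t \<or> t = s"
proof -
  have "\<exists>y. f v \<approx> g @ y @ rev g \<and> (\<forall>t\<in>set y. B s t \<or> t = s)" if uv: "A u v" for v
  proof -
    obtain y where y: "rev g @ f v @ g \<approx> y" "\<forall>t\<in>set y. B s t \<or> t = s"
      using S.centralizer[of s "rev g @ f v @ g"] S.conj_commute[OF assms image_commute[OF uv]]
      by auto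
    then show ?thesis using S.conj_eq_self_iff[of "rev g" "f v" y] by auto
  qed
  then show thesis using that by metis
qed

lemma edge_image:
  assumes "f u \<approx> g @ [s, t] @ rev g" "B s t"
  obtains y where "\<And>v. A u v \<Longrightarrow> f v \<approx> g @ y v @ rev g" "\<And>v. A u v \<Longrightarrow> set (y v) \<subseteq> {s, t}"
proof -
  have "\<exists>y. f v \<approx> g @ y @ rev g \<and> set y \<subseteq> {s, t}" if uv: "A u v" for v
  proof -
    obtain y where y: "rev g @ f v @ g \<approx> y" "set y \<subseteq> {s, t}"
      using S.centralizer_edge[OF assms(2), of "rev g @ f v @ g"]
        S.conj_commute[OF assms(1) image_commute[OF uv]]
      by auto
    then show ?thesis using S.conj_eq_self_iff[of "rev g" "f v" y] by auto
  qed
  then show thesis using that by metis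
qed

lemma conj_nontrivial: "\<not> X \<approx> [] \<Longrightarrow> X \<approx> g @ y @ rev g \<Longrightarrow> \<not> y \<approx> []"
  using S.eq_conj[of y "[]" g] S.append_rev_eq S.eq_trans by fastforce

text \<open>Distinct neighbours of \<open>u\<close> are not adjacent, so their product has a
  nontrivial square, whereas the letters of a clique generate a group of exponent 2.\<close>

lemma image_not_in_clique:
  assumes "A u a" "A u b" "a \<noteq> b"
    "f a \<approx> g @ y a @ rev g" "f b \<approx> g @ y b @ rev g"
    "\<And>s t. s \<in> set (y a @ y b) \<Longrightarrow> t \<in> set (y a @ y b) \<Longrightarrow> B s t \<or> s = t"
  shows False
proof -
  have "\<not> A a b" "\<not> A b a" using assms R.no_triangle R.adj_sym by blast+
  then have "\<not> concat (map f [a, b, a, b]) \<approx> []"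
    using assms adj_V2 R.adj_irrefl by (intro reduced_image R.reduced_alternating) auto
  moreover have "concat (map f [a, b, a, b]) \<approx> g @ concat (map y [a, b, a, b]) @ rev g"
    using assms by (intro S.conj_concat_map) auto
  moreover have "concat (map y [a, b, a, b]) \<approx> []"
    using S.square_clique_word[of "y a @ y b"] assms(6) by simp
  ultimately show False using conj_nontrivial by blast
qed

text \<open>If \<open>f u\<close> were conjugate to an edge product \<open>s t\<close>, the images
  of both neighbours would be words in the clique \<open>{s, t}\<close> after one common
  conjugation.\<close>

lemma vertex_image:
  assumes "A u a" "A u b" "a \<noteq> b"
  obtains g s where "f u \<approx> g @ [s] @ rev g"
proof (rule image_cases[OF adj_V[OF assms(1)]])
  fix g s t
  assume st: "B s t" "f u \<approx> g @ [s, t] @ rev g"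
  obtain y where y: "\<And>v. A u v \<Longrightarrow> f v \<approx> g @ y v @ rev g" "\<And>v. A u v \<Longrightarrow> set (y v) \<subseteq> {s, t}"
    using edge_image[OF st(2,1)] by blast
  have "p \<in> {s, t}" if "p \<in> set (y a @ y b)" for p using y(2)[of a] y(2)[of b] assms that by auto
  then have False
    using st(1) S.adj_sym by (intro image_not_in_clique[OF assms y(1)[of a] y(1)[of b]] assms) blast
  then show thesis ..
qed (use that in blast)

text \<open>If \<open>s\<close> had at most one neighbour, its star would be a clique, and up to
  conjugation by \<open>g\<close> this star supports the images of the neighbours of
  \<open>u\<close>.\<close>

lemma vertex_image_degree2:
  assumes "A u a" "A u b" "a \<noteq> b" "f u \<approx> g @ [s] @ rev g"
  shows "\<exists>p q. p \<noteq> q \<and> B s p \<and> B s q"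
proof (rule ccontr)
  assume *: "\<not> ?thesis"
  obtain y where y: "\<And>v. A u v \<Longrightarrow> f v \<approx> g @ y v @ rev g"
    "\<And>v t. A u v \<Longrightarrow> t \<in> set (y v) \<Longrightarrow> B s t \<or> t = s"
    using star_image[OF assms(4)] by blast
  have "B s p \<or> p = s" if "p \<in> set (y a @ y b)" for p using y(2) assms that by auto
  then show False
    using * S.adj_sym
    by (intro image_not_in_clique[OF assms(1-3) y(1)[of a] y(1)[of b]] assms) blast
qed

text \<open>
  In the centralizer of a vertex of degree 2, a product of \<open>\<int>/2\<close> and an infinite dihedral group,
  squares commute; in a free product of three copies of \<open>\<int>/2\<close> they do not.
\<close>

lemma vertex_image_degree3:
  assumes "A u a" "A u b" "A u c" "distinct [a, b, c]" "f u \<approx> g @ [s] @ rev g"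
  shows "\<exists>p q r. distinct [p, q, r] \<and> B s p \<and> B s q \<and> B s r"
proof (rule ccontr)
  assume *: "\<not> ?thesis"
  obtain p q where pq: "p \<noteq> q" "B s p" "B s q"
    using vertex_image_degree2[of u a b g s] assms by auto
  then have link: "r = p \<or> r = q" if "B s r" for r using * that by auto
  obtain y where y: "\<And>v. A u v \<Longrightarrow> f v \<approx> g @ y v @ rev g"
    "\<And>v t. A u v \<Longrightarrow> t \<in> set (y v) \<Longrightarrow> B s t \<or> t = s"
    using star_image[OF assms(5)] by blast
  let ?v = "y a @ y b" and ?w = "y a @ y c"
  let ?v' = "filter (\<lambda>t. t \<noteq> s) ?v" and ?w' = "filter (\<lambda>t. t \<noteq> s) ?w"
  have v: "?v @ ?v \<approx> ?v' @ ?v'" and w: "?w @ ?w \<approx> ?w' @ ?w'"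
    using y(2) assms by (intro S.star_word_square; auto)+
  have "(?v @ ?v) @ ?w @ ?w \<approx> (?v' @ ?v') @ ?w' @ ?w'"
    by (rule S.eq_append[OF v w])
  also have "\<dots> \<approx> (?w' @ ?w') @ ?v' @ ?v'"
    using link y(2) assms by (intro S.dihedral_even_words_commute[of _ _ p q]) fastforce+
  also have "\<dots> \<approx> (?w @ ?w) @ ?v @ ?v"
    by (rule S.eq_append[OF S.eq_sym[OF w] S.eq_sym[OF v]])
  finally have vw: "(?v @ ?v) @ ?w @ ?w \<approx> (?w @ ?w) @ ?v @ ?v" .
  let ?V = "[a, b, a, b]" and ?W = "[a, c, a, c]"
  have "concat (map f (?V @ ?W)) \<approx> g @ concat (map y (?V @ ?W)) @ rev g"
    using assms y(1) by (intro S.conj_concat_map) auto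
  also have "\<dots> \<approx> g @ concat (map y (?W @ ?V)) @ rev g"
    using S.eq_conj[OF vw, of g] by simp
  also have "\<dots> \<approx> concat (map f (?W @ ?V))"
    using assms y(1) by (intro S.eq_sym[OF S.conj_concat_map]) auto
  finally have "racg_eq A (?V @ ?W) (?W @ ?V)"
    using embedding[of "?V @ ?W" "?W @ ?V"] assms adj_V2 by simp
  \<comment> \<open>Brought to one side, the relation becomes \<open>abab acac baba caca\<close>, an
    alternating word in pairwise non-adjacent letters and hence reduced.\<close>
  then have "racg_eq A ((?V @ ?W) @ rev (?W @ ?V)) []"
    using R.eq_trans[OF R.eq_append[OF _ R.eq_refl] R.append_rev_eq] by blast
  moreover have "\<not> A x x'" if "x \<in> {a, b, c}" "x' \<in> {a, b, c}" for x x'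
    using assms that R.no_triangle[of u] by auto
  then have "R.reduced ((?V @ ?W) @ rev (?W @ ?V))"
    using assms(4) by (intro R.reduced_alternating) auto
  ultimately show False using R.reduced_nonempty by blast
qed

text \<open>In the frame \<open>g\<close>, the image of \<open>v\<close> is a word \<open>y\<close>
  in the star of \<open>s\<close>, and parity shows that \<open>t\<close> occurs in it. So only
  \<open>t = s\<close> has to be excluded. In that case the part of \<open>y\<close> away from
  \<open>s\<close> squares to the identity and has even parity in every letter, which is impossible
  for an involution; it is thus trivial, and \<open>f v\<close> equals \<open>f u\<close>.\<close>

lemma vertex_image_adj:
  assumes "A u v" "f u \<approx> g @ [s] @ rev g" "f v \<approx> k @ [t] @ rev k"
  shows "B s t"
proof (rule ccontr)
  assume nst: "\<not> B s t"
  obtain y where y: "f v \<approx> g @ y @ rev g" "\<forall>t\<in>set y. B s t \<or> t = s"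
    using star_image[OF assms(2)] assms(1) by metis
  have v: "v \<in> V" using adj_V2 assms(1) .
  have odd: "odd (count_list y p) \<longleftrightarrow> p = t" for p
  proof -
    have "g @ y @ rev g \<approx> k @ [t] @ rev k" using y(1) assms(3) S.eq_sym S.eq_trans by blast
    from S.odd_count_cong[OF this, of p] show ?thesis by (auto split: if_splits)
  qed
  then have "t \<in> set y" by (metis count_list_0_iff even_zero)
  then have ts: "t = s" using y(2) nst by blast
  define z where "z = filter (\<lambda>t. t \<noteq> s) y"
  define e where "e = filter (\<lambda>t. t = s) y"
  have ze: "y \<approx> z @ e" using S.star_word_split y(2) unfolding z_def e_def by blast
  have "g @ (y @ y) @ rev g \<approx> f v @ f v"
    using S.conj_append[of g y y] S.eq_append[OF y(1) y(1)] S.eq_sym S.eq_trans by blast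
  then have "g @ (y @ y) @ rev g \<approx> []" using image_involution[OF v] S.eq_trans by blast
  then have "y @ y \<approx> []"
    using conj_nontrivial S.eq_refl by (metis S.conj_eq_self_iff S.rev_append_eq S.eq_trans append_Nil)
  then have zz: "z @ z \<approx> []"
    using S.star_word_square[OF y(2)] S.eq_sym S.eq_trans unfolding z_def by blast
  have even: "even (count_list z p)" for p
  proof -
    have "count_list z p = (if p = s then 0 else count_list y p)"
      unfolding z_def by (induction y) auto
    then show ?thesis using odd[of p] ts by (cases "p = s") simp_all
  qed
  have "z \<approx> []"
  proof (rule ccontr)
    assume "\<not> z \<approx> []"
    then consider h p where "z \<approx> h @ [p] @ rev h" | h p q where "B p q" "z \<approx> h @ [p, q] @ rev h"
      using S.involution_cases[OF zz] by blast
    then show False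
    proof cases
      case 1
      then show False using S.odd_count_cong[OF 1, of p] even[of p] by simp
    next
      case 2
      then show False using S.odd_count_cong[OF 2(2), of p] even[of p] S.adj_irrefl
        by (auto split: if_splits)
    qed
  qed
  then have "y \<approx> [] @ e" using ze S.eq_append[OF _ S.eq_refl] S.eq_trans by blast
  moreover have "e \<approx> [] \<or> e \<approx> [s]" by (intro S.single_letter_word) (auto simp: e_def)
  ultimately have "y \<approx> [] \<or> y \<approx> [s]" using S.eq_trans by auto
  moreover have "\<not> y \<approx> []" using conj_nontrivial[OF image_nontrivial[OF v] y(1)] .
  ultimately have "f v \<approx> g @ [s] @ rev g" using y(1) S.eq_conj S.eq_trans by blast
  then have "f u \<approx> f v" using assms(2) S.eq_sym S.eq_trans by blast
  then show False using image_distinct assms(1) adj_V v R.adj_irrefl by metis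
qed

text \<open>Serves the source tree that is a single edge. Without edges in \<open>B\<close>,
  \<open>f u\<close> is conjugate to a letter whose centralizer has order 2, which leaves no room
  for a second involution \<open>f v\<close>.\<close>

lemma edge_exists:
  assumes "A u v"
  shows "\<exists>s t. B s t"
proof (rule ccontr)
  assume *: "\<not> ?thesis"
  then obtain g s where s: "f u \<approx> g @ [s] @ rev g"
    using image_cases[OF adj_V[OF assms]] by blast
  obtain y where y: "f v \<approx> g @ y @ rev g" "\<forall>t\<in>set y. B s t \<or> t = s"
    using star_image[OF s] assms by metis
  then have "y \<approx> [] \<or> y \<approx> [s]" using * by (intro S.single_letter_word) blast
  moreover have "\<not> y \<approx> []" using conj_nontrivial image_nontrivial adj_V2[OF assms] y(1) by blast
  ultimately have "f v \<approx> g @ [s] @ rev g" using y(1) S.eq_conj S.eq_trans by blast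
  then have "f u \<approx> f v" using s S.eq_sym S.eq_trans by blast
  then show False using image_distinct assms adj_V adj_V2 R.adj_irrefl by metis
qed

end

section \<open>The embedding of a graph morphism\<close>

text \<open>
  The generator \<open>u\<close> is sent to the conjugate of \<open>\<phi> u\<close> by \<open>g u\<close>. The word \<open>h u v\<close> over the link of
  \<open>\<phi> u\<close> takes the frame \<open>g u\<close> to a frame shared by \<open>u\<close> and its neighbour \<open>v\<close>.
\<close>

locale racg_frames = R: triangle_free_graph A + S: triangle_free_graph B
  for A :: "'a \<Rightarrow> 'a \<Rightarrow> bool" and B :: "'b \<Rightarrow> 'b \<Rightarrow> bool" +
  fixes V :: "'a set" and \<phi> :: "'a \<Rightarrow> 'b" and h :: "'a \<Rightarrow> 'a \<Rightarrow> 'b list" and g :: "'a \<Rightarrow> 'b list"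
  assumes adj_V: "A u v \<Longrightarrow> u \<in> V"
    and nonempty: "V \<noteq> {}"
    and connected: "u \<in> V \<Longrightarrow> v \<in> V \<Longrightarrow> A\<^sup>*\<^sup>* u v"
    and no_square: "B s t \<Longrightarrow> B t p \<Longrightarrow> B p q \<Longrightarrow> B q s \<Longrightarrow> s = p \<or> t = q"
    and morphism: "A u v \<Longrightarrow> B (\<phi> u) (\<phi> v)"
    and frame: "A u v \<Longrightarrow> racg_eq B (g v @ h v u) (g u @ h u v)"
    and link: "A u v \<Longrightarrow> t \<in> set (h u v) \<Longrightarrow> B (\<phi> u) t"
    and last_link: "A u v \<Longrightarrow> h u v = [] \<or> distinct_adj (h u v) \<and> last (h u v) \<noteq> \<phi> v"
    and transition: "A u v \<Longrightarrow> A u w \<Longrightarrow> v \<noteq> w \<Longrightarrow> \<exists>k. k \<noteq> [] \<and> distinct_adj k \<and>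
      (\<forall>t\<in>set k. B (\<phi> u) t) \<and> hd k \<noteq> \<phi> v \<and> last k \<noteq> \<phi> w \<and>
      racg_eq B (rev (h u v) @ h u w) k"
begin

no_notation R.word_eq (infix \<open>\<approx>\<close> 50)
notation S.word_eq (infix \<open>\<approx>\<close> 50)

definition image :: "'a \<Rightarrow> 'b list" where
  "image u = g u @ [\<phi> u] @ rev (g u)"

text \<open>The half-space of the reflection \<open>image u\<close> on the side away from \<open>g u\<close>.\<close>

definition halfspace :: "'a \<Rightarrow> 'b list \<Rightarrow> bool" where
  "halfspace u w \<longleftrightarrow> S.desc (\<phi> u) (rev (g u) @ w)"

lemma halfspace_cong: "v \<approx> w \<Longrightarrow> halfspace u v = halfspace u w"
  unfolding halfspace_def by (intro S.desc_cong S.eq_append) auto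

text \<open>The letters of \<open>h u v\<close> are adjacent to \<open>\<phi> u\<close>, so passing
  to the frame shared with \<open>v\<close> does not affect whether \<open>\<phi> u\<close> is a
  descent.\<close>

lemma halfspace_frame: "A u v \<Longrightarrow> halfspace u w \<longleftrightarrow> S.desc (\<phi> u) (rev (g u @ h u v) @ w)"
  using S.desc_append_link[of "rev (h u v)" "\<phi> u" "rev (g u) @ w"] link
  by (auto simp: halfspace_def)

lemma image_frame:
  assumes "A u v"
  shows "image u \<approx> (g u @ h u v) @ [\<phi> u] @ rev (g u @ h u v)"
proof -
  have "h u v @ [\<phi> u] @ rev (h u v) \<approx> [\<phi> u]"
  proof -
    have "[\<phi> u] @ h u v \<approx> h u v @ [\<phi> u]" using link assms by (intro S.commute_letters) auto
    then have "h u v @ [\<phi> u] @ rev (h u v) \<approx> [\<phi> u] @ h u v @ rev (h u v)"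
      using S.eq_append[OF S.eq_sym S.eq_refl, of "[\<phi> u] @ h u v" "h u v @ [\<phi> u]" "rev (h u v)"] by simp
    also have "\<dots> \<approx> [\<phi> u] @ []" by (rule S.eq_append[OF S.eq_refl S.append_rev_eq])
    finally show ?thesis by simp
  qed
  from S.eq_sym[OF S.eq_conj[OF this, of "g u"]] show ?thesis by (simp add: image_def)
qed

lemma image_frame2:
  assumes "A u v"
  shows "image v \<approx> (g u @ h u v) @ [\<phi> v] @ rev (g u @ h u v)"
proof -
  note F = frame[OF assms]
  have "image v \<approx> (g v @ h v u) @ [\<phi> v] @ rev (g v @ h v u)"
    by (rule image_frame[OF R.adj_sym[OF assms]])
  also have "\<dots> \<approx> (g u @ h u v) @ [\<phi> v] @ rev (g u @ h u v)"
    by (rule S.eq_append[OF F S.eq_append[OF S.eq_refl S.eq_rev[OF F]]])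
  finally show ?thesis .
qed

lemma image_commute:
  assumes "A u v"
  shows "image u @ image v \<approx> image v @ image u"
proof -
  let ?F = "g u @ h u v"
  have "image u @ image v \<approx> ?F @ ([\<phi> u] @ [\<phi> v]) @ rev ?F"
    by (rule S.eq_trans[OF S.eq_append[OF image_frame[OF assms] image_frame2[OF assms]] S.conj_append])
  also have "\<dots> \<approx> ?F @ ([\<phi> v] @ [\<phi> u]) @ rev ?F"
    using morphism[OF assms] by (intro S.eq_conj S.commute_letters) auto
  also have "\<dots> \<approx> image v @ image u"
    by (rule S.eq_sym[OF S.eq_trans[OF
      S.eq_append[OF image_frame2[OF assms] image_frame[OF assms]] S.conj_append]])
  finally show ?thesis .
qed

lemma image_involution: "image u @ image u \<approx> []"
proof -
  have "image u @ image u \<approx> g u @ ([\<phi> u] @ [\<phi> u]) @ rev (g u)"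
    unfolding image_def by (rule S.conj_append)
  also have "\<dots> \<approx> g u @ [] @ rev (g u)" using S.eq_cancel[of "\<phi> u" "[]"] by (intro S.eq_conj) simp
  also have "\<dots> \<approx> []" using S.append_rev_eq by simp
  finally show ?thesis .
qed

lemma halfspace_image_self: "halfspace u (image u @ w) \<longleftrightarrow> \<not> halfspace u w"
  using S.desc_cong[OF S.rev_append_left[of "g u" "[\<phi> u] @ rev (g u) @ w"], of "\<phi> u"]
  by (simp add: halfspace_def image_def)

lemma halfspace_image_adj:
  assumes "A u v"
  shows "halfspace u (image v @ w) \<longleftrightarrow> halfspace u w"
proof -
  let ?F = "g u @ h u v"
  have "rev ?F @ image v @ w \<approx> rev ?F @ (?F @ [\<phi> v] @ rev ?F) @ w"
    by (rule S.eq_append[OF S.eq_refl S.eq_append[OF image_frame2[OF assms] S.eq_refl]])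
  also have "\<dots> \<approx> \<phi> v # rev ?F @ w" using S.rev_append_left[of ?F "[\<phi> v] @ rev ?F @ w"] by simp
  finally show ?thesis
    using S.desc_cong S.desc_Cons_adj[OF morphism[OF assms]] halfspace_frame[OF assms] by blast
qed

text \<open>Seen from the frame shared by \<open>u\<close> and \<open>u'\<close>, a point in the
  half-space of \<open>v\<close> has a descent pointing towards \<open>v\<close>. The induction
  starts at the far end of the path; at each inner vertex the transition word converts the descent
  found beyond it into one in the link of that vertex.\<close>

lemma path_desc:
  assumes "rtrancl_path A u (u' # us) v" "distinct (u # u' # us)" "halfspace v w"
  shows "\<exists>p. S.desc p (rev (g u @ h u u') @ w) \<and> p \<noteq> \<phi> u \<and> (if us = [] then p = \<phi> u' else B (\<phi> u') p)"
  using assms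
proof (induction us arbitrary: u u')
  case Nil
  then have uv: "A u u'" "u' = v" by (auto elim: rtrancl_path.cases)
  have "rev (g v @ h v u) @ w \<approx> rev (g u @ h u v) @ w"
    using S.eq_append[OF S.eq_rev[OF frame[of u v]] S.eq_refl] uv by blast
  then have "S.desc (\<phi> v) (rev (g u @ h u v) @ w)"
    using halfspace_frame[of v u w] Nil uv R.adj_sym S.desc_cong by blast
  then show ?case using uv morphism S.adj_irrefl by fastforce
next
  case (Cons u'' us)
  then have uu: "A u u'" "A u' u''" and path: "rtrancl_path A u' (u'' # us) v" and ne: "u \<noteq> u''"
    by (auto elim: rtrancl_path.cases)
  let ?w = "rev (g u' @ h u' u'') @ w"
  obtain p where p: "S.desc p ?w" "p \<noteq> \<phi> u'" "if us = [] then p = \<phi> u'' else B (\<phi> u'') p"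
    using Cons.IH[OF path] Cons.prems by auto
  \<comment> \<open>The descent \<open>p\<close> is \<open>\<phi> u''\<close> or adjacent to it. A
    descent \<open>t\<close> in the link of \<open>\<phi> u'\<close> other than
    \<open>\<phi> u''\<close> would have to be adjacent to \<open>p\<close> and so complete a
    triangle or a square.\<close>
  have side: "\<not> S.desc t ?w" if t: "B (\<phi> u') t" "t \<noteq> \<phi> u''" for t
  proof
    assume d: "S.desc t ?w"
    have b: "B (\<phi> u') (\<phi> u'')" using morphism uu by blast
    have "t \<noteq> p" using p t b S.no_triangle[of "\<phi> u'" "\<phi> u''" p] by (auto split: if_splits)
    then have "B t p" using d p S.desc_unique by blast
    then show False
      using p t b S.no_triangle[of "\<phi> u'" t "\<phi> u''"] no_square[of "\<phi> u'" t p "\<phi> u''"] S.adj_sym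
      by (auto split: if_splits)
  qed
  obtain k where k: "k \<noteq> []" "distinct_adj k" "\<forall>t\<in>set k. B (\<phi> u') t" "hd k \<noteq> \<phi> u"
    "last k \<noteq> \<phi> u''" "rev (h u' u) @ h u' u'' \<approx> k"
    using transition[OF R.adj_sym[OF uu(1)] uu(2) ne] by blast
  have nonadj: "\<not> B s t" if "s \<in> set k" "t \<in> set k" for s t
    using k(3) that S.no_triangle by blast
  \<comment> \<open>The last letter of \<open>k\<close> differs from \<open>\<phi> u''\<close>, so
    by \<open>side\<close> it is no descent of \<open>?w\<close>, and ping-pong along
    \<open>k\<close> starts.\<close>
  have "S.desc (hd k) (k @ ?w)"
    using k nonadj side by (intro S.desc_alternating) auto
  moreover have "rev (g u @ h u u') @ w \<approx> k @ ?w"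
  proof -
    have "rev (g u @ h u u') @ w \<approx> rev (h u' u) @ rev (g u') @ w"
      using S.eq_append[OF S.eq_rev[OF S.eq_sym[OF frame[OF uu(1)]]] S.eq_refl, of w] by simp
    also have "\<dots> \<approx> rev (h u' u) @ h u' u'' @ rev (h u' u'') @ rev (g u') @ w"
      by (rule S.eq_append[OF S.eq_refl S.eq_sym[OF S.append_rev_left]])
    also have "\<dots> \<approx> k @ ?w" using S.eq_append[OF k(6) S.eq_refl, of ?w] by simp
    finally show ?thesis .
  qed
  ultimately have "S.desc (hd k) (rev (g u @ h u u') @ w)" using S.desc_cong by blast
  then show ?case using k by (intro exI[of _ "hd k"]) auto
qed

lemma path_exists:
  assumes "u \<in> V" "v \<in> V" "u \<noteq> v"
  obtains u' us where "rtrancl_path A u (u' # us) v" "distinct (u # u' # us)"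
proof -
  obtain xs where xs: "rtrancl_path A u xs v" "distinct (u # xs)"
    using connected assms rtranclp_eq_rtrancl_path rtrancl_path_distinct by metis
  then show thesis using that assms by (cases xs) (auto elim: rtrancl_path.cases)
qed

text \<open>The descent towards a non-adjacent \<open>v\<close> is a neighbour of
  \<open>\<phi> u'\<close>. If \<open>\<phi> u\<close> were a descent too, the two would be adjacent
  and form a triangle with \<open>\<phi> u'\<close>.\<close>

lemma halfspaces_disjoint:
  assumes "u \<in> V" "v \<in> V" "u \<noteq> v" "\<not> A u v" "halfspace v w"
  shows "\<not> halfspace u w"
proof -
  obtain u' us where p: "rtrancl_path A u (u' # us) v" "distinct (u # u' # us)"
    using path_exists assms by blast
  then have uu: "A u u'" and us: "us \<noteq> []" using assms(4) by (auto elim: rtrancl_path.cases)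
  obtain p where p: "S.desc p (rev (g u @ h u u') @ w)" "p \<noteq> \<phi> u" "B (\<phi> u') p"
    using path_desc[OF p assms(5)] us by auto
  then have "\<not> B (\<phi> u) p" using morphism[OF uu] S.no_triangle by blast
  then show ?thesis using halfspace_frame[OF uu] p S.desc_unique by blast
qed

text \<open>Any frame \<open>g r\<close> can serve as base point of the ping-pong. For
  \<open>v\<close> other than \<open>r\<close>, the descent towards \<open>v\<close> and the last
  letter of \<open>h r r'\<close> would both be descents of \<open>rev (h r r')\<close>, completing
  a triangle or a square with \<open>\<phi> r\<close> and \<open>\<phi> r'\<close>.\<close>

lemma halfspace_base: "r \<in> V \<Longrightarrow> v \<in> V \<Longrightarrow> \<not> halfspace v (g r)"
proof
  assume *: "r \<in> V" "v \<in> V" "halfspace v (g r)"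
  show False
  proof (cases "v = r")
    case True
    then show False using * S.desc_cong[OF S.rev_append_eq] by (auto simp: halfspace_def)
  next
    case False
    then obtain r' rs where p: "rtrancl_path A r (r' # rs) v" "distinct (r # r' # rs)"
      using path_exists * by metis
    then have rr: "A r r'" by (auto elim: rtrancl_path.cases)
    let ?h = "h r r'"
    obtain p where p: "S.desc p (rev (g r @ ?h) @ g r)" "p \<noteq> \<phi> r" "p = \<phi> r' \<or> B (\<phi> r') p"
      using path_desc[OF p *(3)] by (auto split: if_splits)
    have "rev (g r @ ?h) @ g r \<approx> rev ?h"
      using S.eq_append[OF S.eq_refl S.rev_append_eq, of "rev ?h" "g r"] by simp
    then have d: "S.desc p (rev ?h)" using p S.desc_cong by blast
    then have ne: "?h \<noteq> []" by auto
    let ?t = "last ?h"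
    have "\<not> B s t" if "s \<in> set ?h" "t \<in> set ?h" for s t
      using link[OF rr] that S.no_triangle by blast
    then have dt: "S.desc ?t (rev ?h)"
      using S.desc_alternating[of "rev ?h" "[]"] ne last_link[OF rr] by (auto simp: hd_rev)
    have t: "B (\<phi> r) ?t" "?t \<noteq> \<phi> r'" using link[OF rr] last_link[OF rr] ne by auto
    have b: "B (\<phi> r) (\<phi> r')" using morphism rr by blast
    have "?t \<noteq> p" using p t b S.no_triangle by blast
    then have "B ?t p" using d dt S.desc_unique by blast
    then show False using p t b S.no_triangle no_square[of "\<phi> r" ?t p "\<phi> r'"] S.adj_sym by blast
  qed
qed

text \<open>Ping-pong: \<open>image v\<close> carries a point outside the half-space of
  \<open>v\<close> into it, hence out of those of the other non-adjacent vertices, and preserves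
  membership in those of the adjacent ones. Descents of reduced words follow the same rules.\<close>

lemma halfspace_iff_desc:
  assumes "r \<in> V" "u \<in> V" "w \<in> lists V" "R.reduced w"
  shows "halfspace u (concat (map image w) @ g r) \<longleftrightarrow> R.desc u w"
  using assms(2-)
proof (induction w arbitrary: u)
  case Nil
  then show ?case using halfspace_base assms(1) by simp
next
  case (Cons v w)
  have v: "halfspace v (image v @ concat (map image w) @ g r)"
    using Cons by (auto simp: halfspace_image_self)
  consider "u = v" | "A u v" | "u \<noteq> v" "\<not> A u v" by blast
  then show ?case
  proof cases
    case 1
    then show ?thesis using v Cons.prems by simp
  next
    case 2
    then show ?thesis using Cons by (auto simp: halfspace_image_adj R.desc_Cons_adj)
  next
    case 3
    then have "\<not> R.desc u (v # w)" using R.desc_unique Cons.prems by fastforce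
    moreover have "\<not> halfspace u (image v @ concat (map image w) @ g r)"
      using halfspaces_disjoint 3 v Cons.prems by auto
    ultimately show ?thesis by simp
  qed
qed

lemma image_eq: "racg_eq A v w \<Longrightarrow> concat (map image v) \<approx> concat (map image w)"
proof (induction rule: racg_eq.induct)
  case (cancel u s v)
  from S.eq_context[OF image_involution[of s], of "concat (map image u)" "concat (map image v)"]
  show ?case by simp
next
  case (swap s t u v)
  from S.eq_context[OF image_commute[OF swap], of "concat (map image u)" "concat (map image v)"]
  show ?case by simp
qed (auto intro: S.eq_sym S.eq_trans)

text \<open>The first letter of a non-empty reduced word is a descent, so the image of the word
  moves the base point into a half-space.\<close>

lemma image_trivial:
  assumes "w \<in> lists V" "concat (map image w) \<approx> []"
  shows "racg_eq A w []"
proof -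
  obtain v where v: "R.reduced v" "racg_eq A w v" "set v \<subseteq> set w"
    using R.reduced_exists by blast
  then have vV: "v \<in> lists V" using assms(1) by auto
  have triv: "concat (map image v) \<approx> []"
    using S.eq_trans[OF S.eq_sym[OF image_eq[OF v(2)]] assms(2)] .
  obtain r where r: "r \<in> V" using nonempty by blast
  have "v = []"
  proof (rule ccontr)
    assume "v \<noteq> []"
    then obtain s v' where s: "v = s # v'" by (cases v) auto
    then have "halfspace s (concat (map image v) @ g r)"
      using halfspace_iff_desc[OF r _ vV v(1), of s] vV v(1) by simp
    then have "halfspace s (g r)"
      using halfspace_cong[OF S.eq_append[OF triv S.eq_refl], of s "g r"] by simp
    then show False using halfspace_base[OF r, of s] s vV by simp
  qed
  then show ?thesis using v by simp
qed

lemma image_embedding: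
  assumes "w \<in> lists V" "w' \<in> lists V"
  shows "racg_eq A w w' \<longleftrightarrow> concat (map image w) \<approx> concat (map image w')"
proof
  assume *: "concat (map image w) \<approx> concat (map image w')"
  have "concat (map image (w @ rev w')) \<approx> concat (map image (w' @ rev w'))"
    using S.eq_append[OF * S.eq_refl] by simp
  also have "\<dots> \<approx> concat (map image [])" by (rule image_eq[OF R.append_rev_eq])
  finally have "racg_eq A (w @ rev w') []" using assms by (intro image_trivial) auto
  then have "racg_eq A (rev w') (rev w)" by (simp add: R.eq_append_move)
  then show "racg_eq A w w'" using R.eq_rev R.eq_sym by fastforce
qed (rule image_eq)

end

section \<open>Choice of the frames\<close>

context simple_graph
begin

text \<open>
  With at least three letters at hand, \<open>h v = (a b)\<^sup>i c e\<close> for pairwise distinct exponents \<open>i\<close>.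
\<close>

lemma transition_words:
  fixes x :: "'c \<Rightarrow> 'a"
  assumes "finite N" "x ` N \<subseteq> L"
    and two: "card N = 2 \<Longrightarrow> \<exists>p q. {p, q} \<subseteq> L \<and> p \<noteq> q"
    and three: "3 \<le> card N \<Longrightarrow> \<exists>a b c. {a, b, c} \<subseteq> L \<and> distinct [a, b, c]"
  shows "\<exists>h. (\<forall>v\<in>N. set (h v) \<subseteq> L \<and> (h v = [] \<or> distinct_adj (h v) \<and> last (h v) \<noteq> x v)) \<and>
    (\<forall>v\<in>N. \<forall>w\<in>N. v \<noteq> w \<longrightarrow> (\<exists>k. k \<noteq> [] \<and> distinct_adj k \<and> set k \<subseteq> L \<and>
      hd k \<noteq> x v \<and> last k \<noteq> x w \<and> rev (h v) @ h w \<approx> k))"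
proof -
  define good where "good = (\<lambda>h v w k. k \<noteq> [] \<and> distinct_adj k \<and> set k \<subseteq> L \<and>
    hd k \<noteq> x v \<and> last k \<noteq> x w \<and> rev (h v) @ h w \<approx> k)"
  have good_rev: "good h w v (rev k)" if "good h v w k" for h v w k
    using that eq_rev[of "rev (h v) @ h w" k] by (auto simp: good_def hd_rev last_rev)
  consider "card N < 2" | "card N = 2" | "3 \<le> card N" by linarith
  then have "\<exists>h. (\<forall>v\<in>N. set (h v) \<subseteq> L \<and> (h v = [] \<or> distinct_adj (h v) \<and> last (h v) \<noteq> x v)) \<and>
    (\<forall>v\<in>N. \<forall>w\<in>N. v \<noteq> w \<longrightarrow> (\<exists>k. good h v w k))"
  proof cases
    case 1
    then have "v = w" if "v \<in> N" "w \<in> N" for v w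
      using that assms(1) card_le_Suc0_iff_eq[of N] by force
    then show ?thesis by (intro exI[of _ "\<lambda>_. []"]) auto
  next
    case 2
    then obtain v w where N: "N = {v, w}" "v \<noteq> w" by (auto simp: card_2_iff)
    obtain q where q: "q \<in> L" "q \<noteq> x v" using two 2 by blast
    \<comment> \<open>If the two images differ, writing them in this order avoids both forbidden
      ends; if they coincide, one other letter does.\<close>
    define k where "k = (if x v = x w then [q] else [x w, x v])"
    have k: "k \<noteq> []" "distinct_adj k" "set k \<subseteq> L" "hd k \<noteq> x v" "last k \<noteq> x w"
      using q assms(2) N by (auto simp: k_def)
    define h where "h = (\<lambda>z. if z = v then [] else k)"
    have good: "good h v w k" using k N by (auto simp: good_def h_def)
    have "\<exists>k. good h z z' k" if "z \<in> N" "z' \<in> N" "z \<noteq> z'" for z z'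
      using that good good_rev[OF good] N by blast
    moreover have "set (h z) \<subseteq> L \<and> (h z = [] \<or> distinct_adj (h z) \<and> last (h z) \<noteq> x z)" if "z \<in> N" for z
      using that k N by (auto simp: h_def)
    ultimately show ?thesis by blast
  next
    case 3
    then obtain a b c where abc: "{a, b, c} \<subseteq> L" "distinct [a, b, c]" using three by blast
    obtain i :: "'c \<Rightarrow> nat" where i: "inj_on i N"
      using finite_imp_inj_to_nat_seg[OF assms(1)] by metis
    \<comment> \<open>The final letter has to avoid \<open>x v\<close>, and it is taken from
      \<open>a\<close> and \<open>b\<close> so that it differs from the preceding
      \<open>c\<close>.\<close>
    define e where "e = (\<lambda>v. if a = x v then b else a)"
    have e: "e v \<noteq> x v" "e v \<in> L" "e v \<noteq> c" for v using abc by (auto simp: e_def)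
    define alt where "alt = (\<lambda>n. concat (replicate n [a, b]))"
    define h where "h = (\<lambda>v. alt (i v) @ [c, e v])"
    have alt_set: "set (alt n) \<subseteq> L" for n using abc by (induction n) (auto simp: alt_def)
    have alt_adj: "distinct_adj (alt n @ [c, e v]) \<and> hd (alt n @ [c, e v]) \<noteq> b" for n v
    proof (induction n)
      case (Suc n)
      then show ?case using abc by (cases "alt n @ [c, e v]") (auto simp: alt_def)
    qed (use abc e[of v] in \<open>auto simp: alt_def\<close>)
    have ex: "\<exists>k. good h v w k" if vw: "i v < i w" for v w
    proof -
      define m where "m = i w - i v"
      obtain m' where m': "m = Suc m'" using vw by (cases m) (auto simp: m_def)
      have "alt (i w) = alt (i v) @ alt m"
        using vw by (simp add: alt_def m_def flip: concat_append replicate_add)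
      \<comment> \<open>The common power of \<open>a b\<close> cancels; as \<open>m > 0\<close>, the
        remaining power keeps the two letters \<open>c\<close> apart.\<close>
      then have "rev (h v) @ h w \<approx> [e v, c] @ alt m @ [c, e w]"
        using eq_append[OF eq_refl rev_append_left[of "alt (i v)" "alt m @ [c, e w]"], of "[e v, c]"]
        by (simp add: h_def)
      moreover have "distinct_adj (alt m @ [c, e w])" "hd (alt m @ [c, e w]) = a"
        using alt_adj[of m w] by (auto simp: alt_def m')
      then have "distinct_adj ([e v, c] @ alt m @ [c, e w])"
        using abc e[of v] by (cases "alt m @ [c, e w]") auto
      ultimately have "good h v w ([e v, c] @ alt m @ [c, e w])"
        using abc e alt_set by (auto simp: good_def)
      then show ?thesis by blast
    qed
    have "\<exists>k. good h v w k" if "v \<in> N" "w \<in> N" "v \<noteq> w" for v w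
    proof -
      have "i v < i w \<or> i w < i v" using i that by (metis inj_on_contraD linorder_neqE_nat)
      then show ?thesis using ex good_rev by blast
    qed
    moreover have "set (h v) \<subseteq> L \<and> distinct_adj (h v) \<and> last (h v) \<noteq> x v" for v
      using alt_adj e abc alt_set by (auto simp: h_def)
    ultimately show ?thesis by (intro exI[of _ h]) auto
  qed
  then show ?thesis unfolding good_def .
qed

end

section \<open>Propagating data along the edges of a finite tree\<close>

lemma rtrancl_path_inside:
  "rtrancl_path (\<lambda>a b. A a b \<and> a \<in> T \<and> b \<in> T) u xs v \<Longrightarrow> rtrancl_path A u xs v \<and> set xs \<subseteq> T"
  by (induction rule: rtrancl_path.induct) (auto intro: rtrancl_path.intros)

text \<open>Attach the vertices one by one: a new vertex has only one neighbour among the old ones.\<close>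

lemma tree_potential:
  fixes A :: "'a \<Rightarrow> 'a \<Rightarrow> bool" and P :: "'a \<Rightarrow> 'a \<Rightarrow> 'c \<Rightarrow> 'c \<Rightarrow> bool"
  assumes "finite V" and adj_V: "\<And>u v. A u v \<Longrightarrow> u \<in> V \<and> v \<in> V"
    and sym: "\<And>u v. A u v \<Longrightarrow> A v u" and irrefl: "\<And>u. \<not> A u u"
    and connected: "\<And>u v. u \<in> V \<Longrightarrow> v \<in> V \<Longrightarrow> A\<^sup>*\<^sup>* u v"
    and acyclic: "\<And>u xs v. rtrancl_path A u xs v \<Longrightarrow> distinct (u # xs) \<Longrightarrow> A v u \<Longrightarrow> length xs \<le> 1"
    and P_sym: "\<And>u v x y. A u v \<Longrightarrow> P u v x y \<Longrightarrow> P v u y x"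
    and P_total: "\<And>u v x. A u v \<Longrightarrow> x \<in> C \<Longrightarrow> \<exists>y\<in>C. P u v x y"
    and "c \<in> C"
  shows "\<exists>g. (\<forall>u. g u \<in> C) \<and> (\<forall>u v. A u v \<longrightarrow> P u v (g u) (g v))"
proof -
  define inside where "inside = (\<lambda>T a b. A a b \<and> a \<in> T \<and> b \<in> T)"
  define good where "good = (\<lambda>T. T \<subseteq> V \<and> (\<forall>u\<in>T. \<forall>v\<in>T. (inside T)\<^sup>*\<^sup>* u v) \<and>
    (\<exists>g. (\<forall>u. g u \<in> C) \<and> (\<forall>u v. inside T u v \<longrightarrow> P u v (g u) (g v))))"
  have step: "\<exists>v. v \<in> V - T \<and> good (insert v T)" if T: "good T" "T \<noteq> {}" "T \<noteq> V" for T
  proof -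
    obtain g where g: "\<And>u. g u \<in> C" "\<And>u v. inside T u v \<Longrightarrow> P u v (g u) (g v)"
      using T(1) unfolding good_def by blast
    obtain a0 where a0: "a0 \<in> T" using T(2) by blast
    obtain v0 where v0: "v0 \<in> V - T" using T unfolding good_def by blast
    have "A\<^sup>*\<^sup>* a0 v0" using connected a0 v0 T(1) unfolding good_def by blast
    have "\<exists>a v. a \<in> T \<and> v \<notin> T \<and> A a v"
    proof (rule ccontr)
      assume *: "\<not> ?thesis"
      from \<open>A\<^sup>*\<^sup>* a0 v0\<close> have "v0 \<in> T"
        by (induction rule: rtranclp_induct) (use a0 * in auto)
      then show False using v0 by blast
    qed
    then obtain a v where av: "a \<in> T" "v \<notin> T" "A a v" by blast
    \<comment> \<open>A second neighbour \<open>b\<close> in \<open>T\<close> would be joined to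
      \<open>a\<close> by a path inside \<open>T\<close>, which \<open>v\<close> would close to a
      cycle.\<close>
    have unique: "b = a" if "b \<in> T" "A b v" for b
    proof (rule ccontr)
      assume ba: "b \<noteq> a"
      have "(inside T)\<^sup>*\<^sup>* a b" using T(1) av(1) that(1) unfolding good_def by blast
      then obtain xs where xs: "rtrancl_path (inside T) a xs b" "distinct (a # xs)"
        using rtranclp_eq_rtrancl_path rtrancl_path_distinct by metis
      then have "rtrancl_path A a xs b" "set xs \<subseteq> T" 
        using rtrancl_path_inside[of A T a xs b] xs(1) by (simp_all add: inside_def)
      then have "rtrancl_path A v (a # xs) b" "distinct (v # a # xs)"
        using av sym xs(2) by (auto intro: rtrancl_path.intros)
      then have "length (a # xs) \<le> 1" using acyclic that by blast
      then show False using xs ba by (auto elim: rtrancl_path.cases)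
    qed
    let ?T = "insert v T"
    have mono: "(inside ?T)\<^sup>*\<^sup>* u w" if "u \<in> T" "w \<in> T" for u w
    proof -
      have "(inside T)\<^sup>*\<^sup>* u w" using T(1) that unfolding good_def by blast
      then show ?thesis by (rule rtranclp_mono[THEN predicate2D, rotated]) (auto simp: inside_def)
    qed
    have va: "inside ?T a v" "inside ?T v a" using av sym by (auto simp: inside_def)
    have "(inside ?T)\<^sup>*\<^sup>* u w" if "u \<in> ?T" "w \<in> ?T" for u w
    proof -
      have av': "(inside ?T)\<^sup>*\<^sup>* a v" "(inside ?T)\<^sup>*\<^sup>* v a" using va by blast+
      have "(inside ?T)\<^sup>*\<^sup>* u a" using that mono[of u a] av(1) av' by (cases "u = v") auto
      moreover have "(inside ?T)\<^sup>*\<^sup>* a w" using that mono[of a w] av(1) av' by (cases "w = v") auto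
      ultimately show ?thesis by (rule rtranclp_trans)
    qed
    moreover obtain y where y: "y \<in> C" "P a v (g a) y" using P_total av(3) g(1) by blast
    have "P u w ((g(v := y)) u) ((g(v := y)) w)" if "inside ?T u w" for u w
    proof -
      have uw: "A u w" "u \<in> ?T" "w \<in> ?T" using that by (auto simp: inside_def)
      consider "u = v" "w = v" | "u = v" "w \<in> T" | "u \<in> T" "w = v" | "u \<in> T" "w \<in> T"
        using uw by blast
      then show ?thesis
      proof cases
        case 2
        then have "w = a" using unique sym uw by blast
        then show ?thesis using 2 y P_sym av by auto
      next
        case 3
        then have "u = a" using unique uw by blast
        then show ?thesis using 3 y av by auto
      qed (use uw irrefl g(2) av in \<open>auto simp: inside_def\<close>)
    qed
    moreover have "v \<in> V" using adj_V av by blast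
    ultimately have "good ?T"
      using T(1) g(1) y(1) unfolding good_def by (intro conjI exI[of _ "g(v := y)"]) auto
    then show ?thesis using \<open>v \<in> V\<close> av(2) by blast
  qed
  show ?thesis
  proof (cases "V = {}")
    case True
    then show ?thesis using assms(9) adj_V by (intro exI[of _ "\<lambda>_. c"]) auto
  next
    case False
    have "\<exists>T. good T \<and> card T = Suc n" if "n < card V" for n
      using that
    proof (induction n)
      case 0
      obtain v where "v \<in> V" using False by blast
      then have "good {v}" using assms(9) irrefl by (auto simp: good_def inside_def intro!: exI[of _ "\<lambda>_. c"])
      then show ?case by (intro exI[of _ "{v}"]) simp
    next
      case (Suc n)
      then obtain T where T: "good T" "card T = Suc n" by auto
      then obtain v where v: "v \<in> V - T" "good (insert v T)" using step[of T] Suc.prems by fastforce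
      have "finite T" using T(1) assms(1) finite_subset unfolding good_def by blast
      then show ?case using v T by (intro exI[of _ "insert v T"]) simp
    qed
    from this[of "card V - 1"] obtain T where T: "good T" "card T = card V"
      using False assms(1) by (auto simp: card_gt_0_iff)
    then have "T = V" using card_subset_eq[OF assms(1)] unfolding good_def by blast
    then have "good V" using T by blast
    moreover have "inside V u v" if "A u v" for u v using adj_V that by (auto simp: inside_def)
    ultimately show ?thesis unfolding good_def by blast
  qed
qed

section \<open>Trees and degrees\<close>

abbreviation adjacent :: "'a pair_pre_digraph \<Rightarrow> 'a \<Rightarrow> 'a \<Rightarrow> bool" where
  "adjacent G u v \<equiv> (u, v) \<in> parcs G"

lemma path_awalk:
  assumes "rtrancl_path (adjacent G) u xs v" "adjacent G v w"
  defines "p \<equiv> zip (u # xs) (xs @ [w])"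
  shows "set p \<subseteq> parcs G \<and> pcas u p w \<and> pawalk_verts u p = u # xs @ [w]"
  using assms(1,2) unfolding p_def by (induction rule: rtrancl_path.induct) auto

locale tree_graph =
  fixes G :: "'a pair_pre_digraph"
  assumes finite_tree: "finite_tree G"
begin

sublocale pair_graph G
  using finite_tree by (simp add: finite_tree_def)

text \<open>The closed walk has \<open>length xs + 1\<close> arcs. Two arcs only run back and forth
  along one edge, hence the bound 1.\<close>

lemma tree_acyclic:
  assumes "rtrancl_path (adjacent G) u xs v" "distinct (u # xs)" "adjacent G v u"
  shows "length xs \<le> 1"
proof (rule ccontr)
  let ?p = "zip (u # xs) (xs @ [u])"
  assume *: "\<not> ?thesis"
  have "awalk u ?p u" using path_awalk[OF assms(1,3)] assms(3) in_arcsD2 by (simp add: awalk_def)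
  moreover have "distinct (tl (pawalk_verts u ?p))" using path_awalk[OF assms(1,3)] assms(2) by simp
  ultimately have "cycle ?p" using * by (auto simp: cycle_def)
  moreover have "3 \<le> length ?p" using * by simp
  ultimately show False using finite_tree unfolding finite_tree_def by blast
qed

lemma tree_connected:
  assumes "u \<in> pverts G" "v \<in> pverts G"
  shows "(adjacent G)\<^sup>*\<^sup>* u v"
proof -
  have "strongly_connected (with_proj (mk_symmetric (with_proj G)))"
    using finite_tree unfolding finite_tree_def Digraph_Component.connected_def by blast
  then have "u \<rightarrow>\<^sup>*\<^bsub>with_proj (mk_symmetric (with_proj G))\<^esub> v"
    using assms by (auto simp: strongly_connected_def)
  then have "u \<rightarrow>\<^sup>*\<^bsub>with_proj G\<^esub> v" using reachable_mk_symmetric_eq[OF sym_arcs] by simp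
  then have "(u, v) \<in> (parcs G)\<^sup>*" using reachable_rtranclI by fastforce
  then show ?thesis by (simp add: rtranclp_rtrancl_eq)
qed

lemma tree_nonempty: "pverts G \<noteq> {}"
  using finite_tree unfolding finite_tree_def Digraph_Component.connected_def strongly_connected_def
  by simp

sublocale T: triangle_free_graph "adjacent G"
proof
  show "\<not> adjacent G s u" if st: "adjacent G s t" "adjacent G t u" for s t u
  proof
    assume su: "adjacent G s u"
    have "rtrancl_path (adjacent G) s [t, u] u" using st by (auto intro: rtrancl_path.intros)
    moreover have "distinct [s, t, u]" using no_loops' st su by auto
    ultimately have "length [t, u] \<le> 1" using tree_acyclic arcs_symmetric su by blast
    then show False by simp
  qed
qed (use arcs_symmetric no_loops' in blast)+

lemma tree_no_square:
  assumes "adjacent G s t" "adjacent G t p" "adjacent G p q" "adjacent G q s"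
  shows "s = p \<or> t = q"
proof (rule ccontr)
  assume *: "\<not> ?thesis"
  have "rtrancl_path (adjacent G) s [t, p, q] q" using assms by (auto intro: rtrancl_path.intros)
  moreover have "distinct [s, t, p, q]" using no_loops' assms * by auto
  ultimately have "length [t, p, q] \<le> 1" using tree_acyclic assms by blast
  then show False by simp
qed

lemma vertex_degree_card: "vertex_degree G v = card {u. adjacent G v u}"
proof -
  have "out_arcs (with_proj G) v = Pair v ` {u. adjacent G v u}"
    by (auto simp: out_arcs_def)
  then show ?thesis
    by (simp add: vertex_degree_def out_degree_def card_image inj_on_def)
qed

lemma finite_neighbours: "finite {u. adjacent G v u}"
  using pair_finite_verts in_arcsD2 by (auto intro: finite_subset)

lemma degree_ge_2_iff: "2 \<le> vertex_degree G v \<longleftrightarrow> (\<exists>p q. p \<noteq> q \<and> adjacent G v p \<and> adjacent G v q)"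
  unfolding vertex_degree_card using card_le_Suc0_iff_eq[OF finite_neighbours, of v]
  by (force simp: not_less_eq_eq[symmetric] numeral_2_eq_2)

lemma degree_ge_3_iff:
  "3 \<le> vertex_degree G v \<longleftrightarrow>
    (\<exists>p q r. distinct [p, q, r] \<and> adjacent G v p \<and> adjacent G v q \<and> adjacent G v r)"
  (is "?L \<longleftrightarrow> ?R")
proof
  assume ?L
  then obtain N where "N \<subseteq> {u. adjacent G v u}" "card N = 3"
    unfolding vertex_degree_card using obtain_subset_with_card_n by metis
  then show ?R by (auto simp: card_3_iff)
next
  assume ?R
  then obtain p q r where "distinct [p, q, r]" "{p, q, r} \<subseteq> {u. adjacent G v u}" by auto
  then show ?L
    unfolding vertex_degree_card using card_mono[OF finite_neighbours, of "{p, q, r}" v] by auto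
qed

end

section \<open>Presentations and words\<close>

text \<open>Generators are their own inverses, so positive words represent all group
  elements.\<close>

definition tag :: "'a list \<Rightarrow> 'a word" where
  "tag w = map (\<lambda>s. (s, True)) w"

lemma tag_append [simp]: "tag (v @ w) = tag v @ tag w"
  by (simp add: tag_def)

lemma tag_words [simp]: "tag w \<in> words X \<longleftrightarrow> w \<in> lists X"
  by (induction w) (auto simp: tag_def words_def)

lemma words_append [simp]: "v @ w \<in> words X \<longleftrightarrow> v \<in> words X \<and> w \<in> words X"
  by (auto simp: words_def)

definition racg_relators :: "'a pair_pre_digraph \<Rightarrow> 'a word set" where
  "racg_relators G = {[(u, True), (u, True)] | u. u \<in> pverts G} \<union>
    {[(u, True), (v, True), (u, False), (v, False)] | u v. (u, v) \<in> parcs G}"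

abbreviation racg_rel :: "'a pair_pre_digraph \<Rightarrow> ('a word \<times> 'a word) set" where
  "racg_rel G \<equiv> pres_rel (pverts G) (racg_relators G)"

definition word_class :: "'a pair_pre_digraph \<Rightarrow> 'a list \<Rightarrow> 'a word set" where
  "word_class G w = racg_rel G `` {tag w}"

context tree_graph
begin

lemma racg_rel_imp_eq: "(v, w) \<in> racg_rel G \<Longrightarrow> racg_eq (adjacent G) (map fst v) (map fst w)"
proof (induction rule: pres_rel.induct)
  case (cancel u v x b)
  show ?case using racg_eq.cancel[of "adjacent G" "map fst u" x "map fst v"] by simp
next
  case (relator u v r)
  have "racg_eq (adjacent G) (map fst r) []"
  proof -
    consider x where "r = [(x, True), (x, True)]"
      | x y where "adjacent G x y" "r = [(x, True), (y, True), (x, False), (y, False)]"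
      using relator(3) by (auto simp: racg_relators_def)
    then show ?thesis
    proof cases
      case 1
      then show ?thesis using T.eq_cancel[of x "[]"] by simp
    next
      case 2
      have "racg_eq (adjacent G) (x # y # x # [y]) (x # x # y # [y])"
        using 2(1) arcs_symmetric by (intro T.eq_Cons T.eq_swap) blast
      also have "racg_eq (adjacent G) (x # x # y # [y]) [y, y]" by (rule T.eq_cancel)
      also have "racg_eq (adjacent G) [y, y] []" by (rule T.eq_cancel)
      finally show ?thesis using 2 by simp
    qed
  qed
  from T.eq_context[OF this, of "map fst u" "map fst v"] show ?case by simp
qed (auto intro: racg_eq.intros)

lemma racg_rel_square:
  assumes "u \<in> words (pverts G)" "v \<in> words (pverts G)" "s \<in> pverts G"
  shows "(u @ [(s, True), (s, True)] @ v, u @ v) \<in> racg_rel G"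
  using assms by (intro pres_rel.relator) (auto simp: racg_relators_def words_def)

lemma racg_rel_swap:
  assumes "u \<in> words (pverts G)" "v \<in> words (pverts G)" "adjacent G s t"
  shows "(u @ [(s, True), (t, True)] @ v, u @ [(t, True), (s, True)] @ v) \<in> racg_rel G"
proof -
  have st: "s \<in> pverts G" "t \<in> pverts G" using assms(3) in_arcsD1 in_arcsD2 by auto
  let ?r = "[(s, True), (t, True), (s, False), (t, False)]"
  have v: "(x, b) # w \<in> words (pverts G)" if "x \<in> {s, t}" "w \<in> words (pverts G)" for x b w
    using that st by (auto simp: words_def)
  \<comment> \<open>The commutator relator is placed in front of \<open>t s\<close>; cancelling
    \<open>t^-1 t\<close> and then \<open>s^-1 s\<close> leaves \<open>s t\<close>.\<close>
  have "(u @ ?r @ [(t, True), (s, True)] @ v, u @ [(t, True), (s, True)] @ v) \<in> racg_rel G"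
    using assms v by (intro pres_rel.relator) (auto simp: racg_relators_def words_def)
  moreover have "((u @ [(s, True), (t, True), (s, False)]) @ [(t, False), (t, \<not> False)] @ (s, True) # v,
      (u @ [(s, True), (t, True), (s, False)]) @ (s, True) # v) \<in> racg_rel G"
    using assms st v by (intro pres_rel.cancel) (auto simp: words_def)
  moreover have "((u @ [(s, True), (t, True)]) @ [(s, False), (s, \<not> False)] @ v,
      (u @ [(s, True), (t, True)]) @ v) \<in> racg_rel G"
    using assms st v by (intro pres_rel.cancel) (auto simp: words_def)
  ultimately show ?thesis by (simp, meson pres_rel.sym pres_rel.trans)
qed

text \<open>A derivation in \<open>racg_eq\<close> may insert and cancel pairs of letters outside
  the vertex set; filtering them out turns it into a derivation in the presentation.\<close>

lemma racg_eq_imp_rel: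
  "racg_eq (adjacent G) v w \<Longrightarrow>
    (tag (filter (\<lambda>x. x \<in> pverts G) v), tag (filter (\<lambda>x. x \<in> pverts G) w)) \<in> racg_rel G"
proof (induction rule: racg_eq.induct)
  case (refl w)
  show ?case by (rule pres_rel.refl) auto
next
  case (cancel u s v)
  let ?F = "filter (\<lambda>x. x \<in> pverts G)"
  show ?case
  proof (cases "s \<in> pverts G")
    case True
    have "(tag (?F u) @ [(s, True), (s, True)] @ tag (?F v), tag (?F u) @ tag (?F v)) \<in> racg_rel G"
      using True by (intro racg_rel_square) auto
    then show ?thesis using True by (simp add: tag_def)
  next
    case False
    have "tag (?F u) @ tag (?F v) \<in> words (pverts G)" by auto
    from pres_rel.refl[OF this, of "racg_relators G"] show ?thesis using False by simp
  qed
next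
  case (swap s t u v)
  let ?F = "filter (\<lambda>x. x \<in> pverts G)"
  have "(tag (?F u) @ [(s, True), (t, True)] @ tag (?F v),
      tag (?F u) @ [(t, True), (s, True)] @ tag (?F v)) \<in> racg_rel G"
    using swap by (intro racg_rel_swap) auto
  moreover have "s \<in> pverts G" "t \<in> pverts G" using swap in_arcsD1 in_arcsD2 by auto
  ultimately show ?case by (simp add: tag_def)
qed (auto intro: pres_rel.sym pres_rel.trans)

lemma racg_rel_tag: "w \<in> words (pverts G) \<Longrightarrow> (w, tag (map fst w)) \<in> racg_rel G"
proof (induction w)
  case Nil
  then show ?case by (simp add: tag_def pres_rel.refl)
next
  case (Cons l w)
  obtain x b where l: "l = (x, b)" by (cases l)
  have x: "x \<in> pverts G" and w: "w \<in> words (pverts G)" using Cons.prems by (auto simp: l words_def)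
  have Nil: "[] \<in> words (pverts G)" and xw: "(x, c) # w \<in> words (pverts G)" for c
    using x w by (auto simp: words_def)
  have "([(x, b)] @ w, [(x, True)] @ w) \<in> racg_rel G"
  proof (cases b)
    case True
    then show ?thesis using xw by (simp add: pres_rel.refl)
  next
    case False
    \<comment> \<open>The word \<open>x^-1 x x\<close> reduces to \<open>x^-1\<close> by the relator
      and to \<open>x\<close> by cancellation.\<close>
    have "([(x, False)] @ [(x, True), (x, True)] @ w, [(x, False)] @ w) \<in> racg_rel G"
      using x w by (intro racg_rel_square) (auto simp: words_def)
    moreover have "([] @ [(x, False), (x, \<not> False)] @ (x, True) # w, [] @ (x, True) # w) \<in> racg_rel G"
      using Nil xw x by (intro pres_rel.cancel)
    ultimately show ?thesis using False by (simp, meson pres_rel.sym pres_rel.trans)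
  qed
  moreover have "([(x, True)] @ w @ [], [(x, True)] @ tag (map fst w) @ []) \<in> racg_rel G"
    using Cons.IH[OF w] x by (intro pres_rel_append_context) (auto simp: words_def)
  ultimately show ?case using pres_rel.trans by (fastforce simp: l tag_def)
qed

lemma word_class_eq_iff:
  assumes "v \<in> lists (pverts G)" "w \<in> lists (pverts G)"
  shows "word_class G v = word_class G w \<longleftrightarrow> racg_eq (adjacent G) v w"
proof -
  have id: "filter (\<lambda>x. x \<in> pverts G) u = u" if "u \<in> lists (pverts G)" for u
    using that by (auto simp: filter_id_conv)
  have fst_tag: "map fst (tag u) = u" for u :: "'a list" by (induction u) (auto simp: tag_def)
  have "word_class G v = word_class G w \<longleftrightarrow> (tag v, tag w) \<in> racg_rel G"
    unfolding word_class_def using assms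
    by (intro eq_equiv_class_iff[OF equiv_pres_rel]) auto
  also have "\<dots> \<longleftrightarrow> racg_eq (adjacent G) v w"
    using racg_rel_imp_eq[of "tag v" "tag w"] racg_eq_imp_rel[of v w] id assms fst_tag by metis
  finally show ?thesis .
qed

lemma racg_alt_def: "racg G = presented_group (pverts G) (racg_relators G)"
  by (simp add: racg_def racg_relators_def)

lemma carrier_racg: "carrier (racg G) = word_class G ` lists (pverts G)"
proof -
  have carrier: "carrier (racg G) = words (pverts G) // racg_rel G"
    by (simp add: racg_alt_def presented_group_def)
  have fst: "map fst w \<in> lists (pverts G)" if "w \<in> words (pverts G)" for w :: "'a word"
    using that by (fastforce simp: words_def)
  have cls: "racg_rel G `` {w} = word_class G (map fst w)" if "w \<in> words (pverts G)" for w
    unfolding word_class_def by (rule equiv_class_eq[OF equiv_pres_rel racg_rel_tag[OF that]])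
  show ?thesis unfolding carrier
  proof (intro equalityI subsetI)
    fix c
    assume "c \<in> words (pverts G) // racg_rel G"
    then show "c \<in> word_class G ` lists (pverts G)"
      by (rule quotientE) (use fst cls in blast)
  next
    fix c
    assume "c \<in> word_class G ` lists (pverts G)"
    then obtain w where "c = word_class G w" "w \<in> lists (pverts G)" by blast
    then show "c \<in> words (pverts G) // racg_rel G"
      unfolding word_class_def by (simp only: quotientI tag_words)
  qed
qed

lemma mult_racg:
  "v \<in> lists (pverts G) \<Longrightarrow> w \<in> lists (pverts G) \<Longrightarrow>
    word_class G v \<otimes>\<^bsub>racg G\<^esub> word_class G w = word_class G (v @ w)"
  unfolding word_class_def racg_alt_def by (subst presented_group_mult) auto

lemma one_racg: "\<one>\<^bsub>racg G\<^esub> = word_class G []"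
  by (simp add: racg_alt_def presented_group_def word_class_def tag_def)

end

text \<open>An embedding amounts to words for the images of the generators: preserving equality of
  words makes the extension well defined, reflecting it makes the extension injective.\<close>

lemma racg_embedding_iff:
  assumes "finite_tree R" "finite_tree S"
  shows "(\<exists>H. subgroup H (racg S) \<and> racg R \<cong> (racg S)\<lparr>carrier := H\<rparr>) \<longleftrightarrow>
    (\<exists>f. (\<forall>u\<in>pverts R. f u \<in> lists (pverts S)) \<and>
      (\<forall>v\<in>lists (pverts R). \<forall>w\<in>lists (pverts R). racg_eq (adjacent R) v w \<longleftrightarrow>
        racg_eq (adjacent S) (concat (map f v)) (concat (map f w))))"
  (is "?L \<longleftrightarrow> ?R")
proof
  interpret R: tree_graph R by unfold_locales fact
  interpret S: tree_graph S by unfold_locales fact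
  assume ?L
  then obtain H \<psi> where H: "subgroup H (racg S)" and iso: "\<psi> \<in> iso (racg R) ((racg S)\<lparr>carrier := H\<rparr>)"
    unfolding is_iso_def by blast
  have hom: "\<psi> \<in> hom (racg R) (racg S)" and inj: "inj_on \<psi> (carrier (racg R))"
    using iso subgroup.subset[OF H] by (auto simp: iso_iff hom_def Pi_iff)
  interpret \<psi>: group_hom "racg R" "racg S" \<psi>
    using hom by (simp add: group_hom_def group_hom_axioms_def group_racg)
  have "\<exists>w. w \<in> lists (pverts S) \<and> \<psi> (word_class R [u]) = word_class S w" if "u \<in> pverts R" for u
  proof -
    have "word_class R [u] \<in> carrier (racg R)" using that by (auto simp: R.carrier_racg)
    then have "\<psi> (word_class R [u]) \<in> carrier (racg S)" by (rule \<psi>.hom_closed)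
    then show ?thesis by (auto simp: S.carrier_racg)
  qed
  then obtain f where f: "\<And>u. u \<in> pverts R \<Longrightarrow> f u \<in> lists (pverts S)"
    "\<And>u. u \<in> pverts R \<Longrightarrow> \<psi> (word_class R [u]) = word_class S (f u)"
    by metis
  have F: "concat (map f w) \<in> lists (pverts S) \<and> \<psi> (word_class R w) = word_class S (concat (map f w))"
    if "w \<in> lists (pverts R)" for w
    using that
  proof (induction w)
    case Nil
    then show ?case using \<psi>.hom_one by (simp add: R.one_racg S.one_racg)
  next
    case (Cons u w)
    have "word_class R (u # w) = word_class R [u] \<otimes>\<^bsub>racg R\<^esub> word_class R w"
      using Cons.hyps by (subst R.mult_racg) auto
    then have "\<psi> (word_class R (u # w)) = \<psi> (word_class R [u]) \<otimes>\<^bsub>racg S\<^esub> \<psi> (word_class R w)"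
      using Cons.hyps by (auto simp: R.carrier_racg)
    then show ?case using Cons f S.mult_racg[of "f u" "concat (map f w)"] by simp
  qed
  have "racg_eq (adjacent R) v w \<longleftrightarrow> racg_eq (adjacent S) (concat (map f v)) (concat (map f w))"
    if "v \<in> lists (pverts R)" "w \<in> lists (pverts R)" for v w
  proof -
    have "racg_eq (adjacent R) v w \<longleftrightarrow> word_class R v = word_class R w"
      using R.word_class_eq_iff that by simp
    also have "\<dots> \<longleftrightarrow> \<psi> (word_class R v) = \<psi> (word_class R w)"
      using inj that by (intro inj_on_eq_iff[symmetric]) (auto simp: R.carrier_racg)
    also have "\<dots> \<longleftrightarrow> racg_eq (adjacent S) (concat (map f v)) (concat (map f w))"
      using F that S.word_class_eq_iff by simp
    finally show ?thesis .
  qed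
  then show ?R using f(1) by blast
next
  interpret R: tree_graph R by unfold_locales fact
  interpret S: tree_graph S by unfold_locales fact
  assume ?R
  then obtain f where f: "\<And>u. u \<in> pverts R \<Longrightarrow> f u \<in> lists (pverts S)"
    and eq: "\<And>v w. v \<in> lists (pverts R) \<Longrightarrow> w \<in> lists (pverts R) \<Longrightarrow> racg_eq (adjacent R) v w \<longleftrightarrow>
      racg_eq (adjacent S) (concat (map f v)) (concat (map f w))"
    by blast
  define F where "F = (\<lambda>w. concat (map f w))"
  have F: "F w \<in> lists (pverts S)" if "w \<in> lists (pverts R)" for w
    using that f by (induction w) (auto simp: F_def)
  have F_eq: "word_class S (F v) = word_class S (F w) \<longleftrightarrow> word_class R v = word_class R w"
    if "v \<in> lists (pverts R)" "w \<in> lists (pverts R)" for v w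
    using R.word_class_eq_iff[OF that] S.word_class_eq_iff[OF F F] eq that by (simp add: F_def)
  \<comment> \<open>An element is mapped through some representative word; by \<open>F_eq\<close>
    the result does not depend on the choice.\<close>
  define \<psi> where "\<psi> = (\<lambda>c. word_class S (F (SOME w. w \<in> lists (pverts R) \<and> word_class R w = c)))"
  have \<psi>: "\<psi> (word_class R w) = word_class S (F w)" if w: "w \<in> lists (pverts R)" for w
  proof -
    have "\<exists>v. v \<in> lists (pverts R) \<and> word_class R v = word_class R w" using w by blast
    from someI_ex[OF this] show ?thesis unfolding \<psi>_def using F_eq w by blast
  qed
  have "\<psi> \<in> hom (racg R) (racg S)"
  proof (rule homI)
    show "\<psi> c \<in> carrier (racg S)" if c: "c \<in> carrier (racg R)" for c
    proof -
      obtain w where "w \<in> lists (pverts R)" "c = word_class R w"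
        using c unfolding R.carrier_racg by blast
      then show ?thesis unfolding S.carrier_racg using F \<psi> by blast
    qed
    show "\<psi> (c \<otimes>\<^bsub>racg R\<^esub> d) = \<psi> c \<otimes>\<^bsub>racg S\<^esub> \<psi> d"
      if cd: "c \<in> carrier (racg R)" "d \<in> carrier (racg R)" for c d
    proof -
      obtain v w where vw: "v \<in> lists (pverts R)" "w \<in> lists (pverts R)"
        "c = word_class R v" "d = word_class R w"
        using cd unfolding R.carrier_racg by blast
      have "\<psi> (word_class R (v @ w)) = word_class S (F (v @ w))"
        using vw by (intro \<psi>) auto
      then show ?thesis using vw \<psi> F S.mult_racg[of "F v" "F w"] R.mult_racg[of v w]
        by (simp add: F_def)
    qed
  qed
  then interpret \<psi>: group_hom "racg R" "racg S" \<psi>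
    by (simp add: group_hom_def group_hom_axioms_def group_racg)
  have "inj_on \<psi> (carrier (racg R))"
    unfolding R.carrier_racg using \<psi> F_eq by (intro inj_onI) (metis imageE)
  then have "\<psi> \<in> iso (racg R) ((racg S)\<lparr>carrier := \<psi> ` carrier (racg R)\<rparr>)"
    using \<psi>.homh by (auto simp: iso_iff hom_def)
  then show ?L using \<psi>.img_is_subgroup unfolding is_iso_def by blast
qed

theorem theorem1p3:
  fixes R :: "'a pair_pre_digraph" and S :: "'b pair_pre_digraph"
  assumes "finite_tree R" and "finite_tree S"
  shows "(\<exists>H. subgroup H (racg S) \<and> racg R \<cong> (racg S)\<lparr>carrier := H\<rparr>) \<longleftrightarrow>
    (\<exists>\<phi>. graph_morphism R S \<phi> \<and>
      (\<forall>v \<in> pverts R. vertex_degree R v = 2 \<longrightarrow> vertex_degree S (\<phi> v) \<ge> 2) \<and>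
      (\<forall>v \<in> pverts R. vertex_degree R v \<ge> 3 \<longrightarrow> vertex_degree S (\<phi> v) \<ge> 3))"
proof -
  interpret R: tree_graph R by unfold_locales fact
  interpret S: tree_graph S by unfold_locales fact
  show ?thesis unfolding racg_embedding_iff[OF assms]
  proof
    assume "\<exists>f. (\<forall>u\<in>pverts R. f u \<in> lists (pverts S)) \<and>
      (\<forall>v\<in>lists (pverts R). \<forall>w\<in>lists (pverts R). racg_eq (adjacent R) v w \<longleftrightarrow>
        racg_eq (adjacent S) (concat (map f v)) (concat (map f w)))"
    then obtain f where f: "\<And>v w. v \<in> lists (pverts R) \<Longrightarrow> w \<in> lists (pverts R) \<Longrightarrow>
      racg_eq (adjacent R) v w \<longleftrightarrow> racg_eq (adjacent S) (concat (map f v)) (concat (map f w))"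
      by blast
    interpret E: racg_embedding "adjacent R" "adjacent S" "pverts R" f
      using f R.in_arcsD1 by unfold_locales auto
    \<comment> \<open>These are the vertices of degree at least 2, whose images are conjugate to
      single generators.\<close>
    define core where "core = (\<lambda>u. \<exists>a b. a \<noteq> b \<and> adjacent R u a \<and> adjacent R u b)"
    \<comment> \<open>Two adjacent vertices without further neighbours form a connected component,
      hence the whole tree.\<close>
    have closed: "pverts R \<subseteq> {u, v}" if uv: "adjacent R u v" "\<not> core u" "\<not> core v" for u v
    proof
      fix x
      assume x: "x \<in> pverts R"
      have *: "y \<in> {u, v}" if "z \<in> {u, v}" "adjacent R z y" for y z
        using that uv R.arcs_symmetric unfolding core_def by blast
      have "(adjacent R)\<^sup>*\<^sup>* u x" using R.tree_connected x R.in_arcsD1 uv(1) by blast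
      then show "x \<in> {u, v}" by (induction rule: rtranclp_induct) (use * in blast)+
    qed
    show "\<exists>\<phi>. graph_morphism R S \<phi> \<and>
      (\<forall>v \<in> pverts R. vertex_degree R v = 2 \<longrightarrow> vertex_degree S (\<phi> v) \<ge> 2) \<and>
      (\<forall>v \<in> pverts R. vertex_degree R v \<ge> 3 \<longrightarrow> vertex_degree S (\<phi> v) \<ge> 3)"
    proof (cases "\<exists>u. core u")
      case True
      then obtain u0 where u0: "core u0" by blast
      then have u0V: "u0 \<in> pverts R" using R.in_arcsD1 unfolding core_def by blast
      define \<psi> where "\<psi> = (\<lambda>u. SOME s. \<exists>g. racg_eq (adjacent S) (f u) (g @ [s] @ rev g))"
      have \<psi>: "\<exists>g. racg_eq (adjacent S) (f u) (g @ [\<psi> u] @ rev g)" if u: "core u" for u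
      proof -
        obtain a b where ab: "a \<noteq> b" "adjacent R u a" "adjacent R u b"
          using u unfolding core_def by blast
        have "\<exists>s g. racg_eq (adjacent S) (f u) (g @ [s] @ rev g)"
          using E.vertex_image[OF ab(2,3,1)] by blast
        then show ?thesis unfolding \<psi>_def by (rule someI_ex)
      qed
      have two: "\<exists>p q. p \<noteq> q \<and> adjacent S (\<psi> u) p \<and> adjacent S (\<psi> u) q" if "core u" for u
        using \<psi>[OF that] that E.vertex_image_degree2 unfolding core_def by metis
      define nb where "nb = (\<lambda>u. SOME v. adjacent R u v)"
      define \<phi> where "\<phi> = (\<lambda>u. if core u then \<psi> u else SOME t. adjacent S (\<psi> (nb u)) t)"
      \<comment> \<open>The vertex \<open>u\<close> has a neighbour because it is connected to
        \<open>u0\<close>; this neighbour lies in \<open>core\<close>, as otherwise the tree would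
        be a single edge.\<close>
      have nb: "adjacent R u (nb u)" "core (nb u)" if u: "u \<in> pverts R" "\<not> core u" for u
      proof -
        have "(adjacent R)\<^sup>*\<^sup>* u u0" using R.tree_connected u u0V by blast
        then have "\<exists>v. adjacent R u v" using u u0 by (auto elim: converse_rtranclpE)
        then show "adjacent R u (nb u)" unfolding nb_def by (rule someI_ex)
        then show "core (nb u)" using closed[of u "nb u"] u u0 u0V by blast
      qed
      have leaf: "adjacent S (\<psi> (nb u)) (\<phi> u)" if u: "u \<in> pverts R" "\<not> core u" for u
      proof -
        have "\<exists>t. adjacent S (\<psi> (nb u)) t" using two[OF nb(2)[OF u]] by blast
        from someI_ex[OF this] show ?thesis using u by (simp add: \<phi>_def)
      qed
      have adj: "adjacent S (\<phi> u) (\<phi> v)" if uv: "adjacent R u v" for u v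
      proof -
        have V: "u \<in> pverts R" "v \<in> pverts R" using uv R.in_arcsD1 R.in_arcsD2 by blast+
        consider "core u" "core v" | "core u" "\<not> core v" | "\<not> core u" by blast
        then show ?thesis
        proof cases
          case 1
          then obtain g k where "racg_eq (adjacent S) (f u) (g @ [\<psi> u] @ rev g)"
            "racg_eq (adjacent S) (f v) (k @ [\<psi> v] @ rev k)"
            using \<psi> by blast
          from E.vertex_image_adj[OF uv this] show ?thesis using 1 by (simp add: \<phi>_def)
        next
          case 2
          then have "nb v = u" using nb(1)[OF V(2)] uv R.arcs_symmetric unfolding core_def by blast
          then show ?thesis using leaf[OF V(2)] 2 by (simp add: \<phi>_def)
        next
          case 3
          then have v: "nb u = v" using nb(1)[OF V(1)] uv unfolding core_def by blast
          then have "core v" using nb(2)[OF V(1)] 3 by simp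
          then show ?thesis using leaf[OF V(1)] 3 v S.arcs_symmetric by (simp add: \<phi>_def)
        qed
      qed
      have "\<phi> u \<in> pverts S" if "u \<in> pverts R" for u
      proof (cases "core u")
        case True
        then show ?thesis using two[OF True] S.in_arcsD1 by (auto simp: \<phi>_def)
      qed (use leaf that S.in_arcsD2 in blast)
      then have "graph_morphism R S \<phi>" using adj by (auto simp: graph_morphism_def)
      moreover have "vertex_degree S (\<phi> v) \<ge> 2" if "vertex_degree R v = 2" for v
      proof -
        have "core v" using R.degree_ge_2_iff[of v] that by (auto simp: core_def)
        then show ?thesis using two[of v] S.degree_ge_2_iff by (auto simp: \<phi>_def)
      qed
      moreover have "vertex_degree S (\<phi> v) \<ge> 3" if deg: "vertex_degree R v \<ge> 3" for v
      proof -
        obtain a b c where abc: "distinct [a, b, c]" "adjacent R v a" "adjacent R v b" "adjacent R v c"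
          using R.degree_ge_3_iff deg by blast
        then have "core v" by (auto simp: core_def)
        moreover from this obtain g where "racg_eq (adjacent S) (f v) (g @ [\<psi> v] @ rev g)"
          using \<psi> by blast
        ultimately show ?thesis
          using E.vertex_image_degree3[OF abc(2-4,1)] S.degree_ge_3_iff by (simp add: \<phi>_def)
      qed
      ultimately show ?thesis by blast
    next
      case False
      \<comment> \<open>The source is a single vertex or a single edge, so the degree conditions are
        vacuous.\<close>
      have low: "vertex_degree R v \<noteq> 2 \<and> \<not> 3 \<le> vertex_degree R v" for v
        using R.degree_ge_2_iff[of v] False unfolding core_def by fastforce
      have "\<exists>\<phi>. graph_morphism R S \<phi>"
      proof (cases "\<exists>u v. adjacent R u v")
        case True
        then obtain u v where uv: "adjacent R u v" by blast
        obtain s t where st: "adjacent S s t" using E.edge_exists[OF uv] by blast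
        have V: "pverts R \<subseteq> {u, v}" using closed uv False by blast
        have "adjacent S (if x = u then s else t) (if y = u then s else t)" if "adjacent R x y" for x y
        proof -
          have "x \<in> {u, v}" "y \<in> {u, v}" "x \<noteq> y"
            using V that R.in_arcsD1 R.in_arcsD2 R.no_loops' by blast+
          then show ?thesis using st S.arcs_symmetric by auto
        qed
        then show ?thesis
          using S.in_arcsD1[OF st] S.in_arcsD2[OF st]
          by (intro exI[of _ "\<lambda>x. if x = u then s else t"]) (auto simp: graph_morphism_def)
      next
        case no_edge: False
        obtain s where "s \<in> pverts S" using S.tree_nonempty by blast
        then show ?thesis
          using no_edge by (intro exI[of _ "\<lambda>_. s"]) (auto simp: graph_morphism_def)
      qed
      then show ?thesis using low by blast
    qed
  next
    assume "\<exists>\<phi>. graph_morphism R S \<phi> \<and>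
      (\<forall>v \<in> pverts R. vertex_degree R v = 2 \<longrightarrow> vertex_degree S (\<phi> v) \<ge> 2) \<and>
      (\<forall>v \<in> pverts R. vertex_degree R v \<ge> 3 \<longrightarrow> vertex_degree S (\<phi> v) \<ge> 3)"
    then obtain \<phi> where \<phi>: "graph_morphism R S \<phi>"
      and deg2: "\<And>v. v \<in> pverts R \<Longrightarrow> vertex_degree R v = 2 \<Longrightarrow> vertex_degree S (\<phi> v) \<ge> 2"
      and deg3: "\<And>v. v \<in> pverts R \<Longrightarrow> vertex_degree R v \<ge> 3 \<Longrightarrow> vertex_degree S (\<phi> v) \<ge> 3"
      by blast
    have \<phi>_adj: "adjacent S (\<phi> u) (\<phi> v)" if "adjacent R u v" for u v
      using \<phi> that by (auto simp: graph_morphism_def)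
    have \<phi>_V: "\<phi> u \<in> pverts S" if "u \<in> pverts R" for u
      using \<phi> that by (auto simp: graph_morphism_def)
    have "\<exists>h. (\<forall>v\<in>{v. adjacent R u v}. set (h v) \<subseteq> {t. adjacent S (\<phi> u) t} \<and>
        (h v = [] \<or> distinct_adj (h v) \<and> last (h v) \<noteq> \<phi> v)) \<and>
      (\<forall>v\<in>{v. adjacent R u v}. \<forall>w\<in>{v. adjacent R u v}. v \<noteq> w \<longrightarrow>
        (\<exists>k. k \<noteq> [] \<and> distinct_adj k \<and> set k \<subseteq> {t. adjacent S (\<phi> u) t} \<and>
          hd k \<noteq> \<phi> v \<and> last k \<noteq> \<phi> w \<and> racg_eq (adjacent S) (rev (h v) @ h w) k))"
      (is "\<exists>h. ?P u h") for u
    proof (rule S.T.transition_words)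
      show "finite {v. adjacent R u v}" by (rule R.finite_neighbours)
      show "\<phi> ` {v. adjacent R u v} \<subseteq> {t. adjacent S (\<phi> u) t}" using \<phi>_adj by blast
      have u: "u \<in> pverts R" if "card {v. adjacent R u v} \<ge> 2"
        using that R.degree_ge_2_iff[of u] R.in_arcsD1 by (auto simp: R.vertex_degree_card)
      show "\<exists>p q. {p, q} \<subseteq> {t. adjacent S (\<phi> u) t} \<and> p \<noteq> q" if "card {v. adjacent R u v} = 2"
        using deg2[OF u] that S.degree_ge_2_iff[of "\<phi> u"] by (auto simp: R.vertex_degree_card)
      show "\<exists>a b c. {a, b, c} \<subseteq> {t. adjacent S (\<phi> u) t} \<and> distinct [a, b, c]"
        if "3 \<le> card {v. adjacent R u v}"
        using deg3[OF u] that S.degree_ge_3_iff[of "\<phi> u"] by (auto simp: R.vertex_degree_card)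
    qed
    then obtain h where h: "\<And>u. ?P u (h u)" by metis
    have h_link: "adjacent S (\<phi> u) t" if "adjacent R u v" "t \<in> set (h u v)" for u v t
      using conjunct1[OF h, of u] that by auto
    have h_last: "h u v = [] \<or> distinct_adj (h u v) \<and> last (h u v) \<noteq> \<phi> v" if "adjacent R u v" for u v
      using conjunct1[OF h, of u] that by auto
    have "\<exists>g. (\<forall>u. g u \<in> lists (pverts S)) \<and> (\<forall>u v. adjacent R u v \<longrightarrow>
      racg_eq (adjacent S) (g v @ h v u) (g u @ h u v))"
    proof (rule tree_potential[where P = "\<lambda>u v x y. racg_eq (adjacent S) (y @ h v u) (x @ h u v)"])
      show "finite (pverts R)" by (rule R.pair_finite_verts)
      show "\<exists>y\<in>lists (pverts S). racg_eq (adjacent S) (y @ h v u) (x @ h u v)"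
        if uv: "adjacent R u v" "x \<in> lists (pverts S)" for u v x
      proof
        \<comment> \<open>Up to equality in the group, the frame \<open>x\<close> of
          \<open>u\<close> forces the frame of its neighbour \<open>v\<close>: the shared frame is
          \<open>x @ h u v\<close>, and \<open>h v u\<close> has to be undone.\<close>
        have "racg_eq (adjacent S) (x @ h u v @ rev (h v u) @ h v u) (x @ h u v @ [])"
          by (intro S.T.eq_append S.T.eq_refl S.T.rev_append_eq)
        then show "racg_eq (adjacent S) ((x @ h u v @ rev (h v u)) @ h v u) (x @ h u v)" by simp
        have "set (h u v) \<subseteq> pverts S" "set (h v u) \<subseteq> pverts S"
          using h_link uv(1) R.arcs_symmetric S.in_arcsD2 by blast+
        then show "x @ h u v @ rev (h v u) \<in> lists (pverts S)" using uv(2) by auto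
      qed
      show "[] \<in> lists (pverts S)" by simp
    qed (use R.in_arcsD1 R.in_arcsD2 R.arcs_symmetric R.no_loops' R.tree_connected R.tree_acyclic
        S.T.eq_sym in blast)+
    then obtain g where g: "\<And>u. g u \<in> lists (pverts S)"
      "\<And>u v. adjacent R u v \<Longrightarrow> racg_eq (adjacent S) (g v @ h v u) (g u @ h u v)"
      by blast
    interpret F: racg_frames "adjacent R" "adjacent S" "pverts R" \<phi> h g
    proof unfold_locales
      show "pverts R \<noteq> {}" by (rule R.tree_nonempty)
      show "s = p \<or> t = q"
        if "adjacent S s t" "adjacent S t p" "adjacent S p q" "adjacent S q s" for s t p q
        using S.tree_no_square that by blast
      show "\<exists>k. k \<noteq> [] \<and> distinct_adj k \<and> (\<forall>t\<in>set k. adjacent S (\<phi> u) t) \<and> hd k \<noteq> \<phi> v \<and>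
        last k \<noteq> \<phi> w \<and> racg_eq (adjacent S) (rev (h u v) @ h u w) k"
        if uvw: "adjacent R u v" "adjacent R u w" "v \<noteq> w" for u v w
      proof -
        obtain k where "k \<noteq> [] \<and> distinct_adj k \<and> set k \<subseteq> {t. adjacent S (\<phi> u) t} \<and>
          hd k \<noteq> \<phi> v \<and> last k \<noteq> \<phi> w \<and> racg_eq (adjacent S) (rev (h u v) @ h u w) k"
          using conjunct2[OF h, of u] uvw by blast
        then show ?thesis by (intro exI[of _ k]) auto
      qed
    qed (use R.in_arcsD1 R.tree_connected \<phi>_adj g h_link h_last in blast)+
    have "F.image u \<in> lists (pverts S)" if "u \<in> pverts R" for u
      using g(1)[of u] \<phi>_V[OF that] by (auto simp: F.image_def)
    then show "\<exists>f. (\<forall>u\<in>pverts R. f u \<in> lists (pverts S)) \<and>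
      (\<forall>v\<in>lists (pverts R). \<forall>w\<in>lists (pverts R). racg_eq (adjacent R) v w \<longleftrightarrow>
        racg_eq (adjacent S) (concat (map f v)) (concat (map f w)))"
      using F.image_embedding by (intro exI[of _ F.image]) blast
  qed
qed

end
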